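(* Let $\mathcal X$ be a standard Borel space and $\mathcal Y\subseteq\mathbb R^n$ a Borel set. Let $f:\mathcal X\times \mathcal Y\to\mathbb R$ be upper semi-analytic. Assume that there exist maps (not assumed measurable) $b:\mathcal X\to\mathbb R^n$ and $c:\mathcal X\to\mathbb R$ such that $f(x,y)\leq b(x)\cdot y+c(x)$ for every $x\in\mathcal X$ and $y\in\mathcal Y$. Then there exist Borel measurable maps $B:\mathcal X\to\mathbb R^n$ and $C:\mathcal X\to\mathbb R$ such that $f(x,y)\leq B(x)\cdot y+C(x)$ for every $x\in\mathcal X$ and $y\in\mathcal Y$.
   Context: A standard Borel space is a measurable space isomorphic to a Borel subset of a Polish space with its relative Borel $\sigma$-algebra. A subset of a standard Borel space is analytic if it is the projection of a Borel subset of its product with some standard Borel space. For a standard Borel space $\mathcal Z$ and $I\subseteq[-\infty,\infty]$, a function $f:\mathcal Z\to I$ is upper semi-analytic if $\{z: f(z)>\gamma\}$ is analytic for every $\gamma\in\mathbb R$. Here $\mathcal X\times\mathcal Y$ is a standard Borel space with the product structure. $b\cdot y$ denotes the Euclidean inner product. *)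

theory Defs
  imports "HOL-Analysis.Analysis"
begin

definition polish_topology :: "'a topology \<Rightarrow> bool" where
  "polish_topology T \<longleftrightarrow> completely_metrizable_space T \<and> separable_space T"

definition borel_of :: "'a topology \<Rightarrow> 'a measure" where
  "borel_of T = sigma (topspace T) {U. openin T U}"

definition measurable_isomorphic :: "'a measure \<Rightarrow> 'b measure \<Rightarrow> bool" where
  "measurable_isomorphic M N \<longleftrightarrow>
     (\<exists>f g. f \<in> measurable M N \<and> g \<in> measurable N M \<and>
            (\<forall>x\<in>space M. g (f x) = x) \<and> (\<forall>y\<in>space N. f (g y) = y))"

text \<open>
  HOL has no existential quantification over types, so the ambient Polish space is carried by a
  subset of \<^typ>\<open>real\<close>, with an arbitrary Polish topology unrelated to the usual one. A Polish space
  has at most the cardinality of the continuum, so nothing is lost: the lemma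
  \<open>standard_borelI\<close> below admits Polish spaces over any type. The same applies to the second factor
  in \<open>analytic_in\<close>, see \<open>analytic_inI\<close>.
\<close>

definition standard_borel :: "'a measure \<Rightarrow> bool" where
  "standard_borel M \<longleftrightarrow>
     (\<exists>(T :: real topology) A. polish_topology T \<and> A \<in> sets (borel_of T) \<and>
        measurable_isomorphic M (restrict_space (borel_of T) A))"

definition analytic_in :: "'a measure \<Rightarrow> 'a set \<Rightarrow> bool" where
  "analytic_in M S \<longleftrightarrow>
     (\<exists>(N :: real measure) R. standard_borel N \<and> R \<in> sets (M \<Otimes>\<^sub>M N) \<and> S = fst ` R)"

definition upper_semianalytic :: "'a measure \<Rightarrow> ('a \<Rightarrow> ereal) \<Rightarrow> bool" where
  "upper_semianalytic M f \<longleftrightarrow> (\<forall>\<gamma>::real. analytic_in M {z \<in> space M. f z > ereal \<gamma>})"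


lemma space_borel_of: "space (borel_of T) = topspace T"
  unfolding borel_of_def by (rule space_measure_of) (auto dest: openin_subset)

lemma sets_borel_of: "sets (borel_of T) = sigma_sets (topspace T) {U. openin T U}"
  unfolding borel_of_def by (rule sets_measure_of) (auto dest: openin_subset)

lemma continuous_map_imp_measurable:
  assumes "continuous_map S T f"
  shows "f \<in> measurable (borel_of S) (borel_of T)"
  unfolding borel_of_def[of T]
proof (rule measurable_measure_of)
  show "{U. openin T U} \<subseteq> Pow (topspace T)"
    by (auto dest: openin_subset)
  show "f \<in> space (borel_of S) \<rightarrow> topspace T"
    using continuous_map_image_subset_topspace[OF assms] by (auto simp: space_borel_of)
next
  fix U assume "U \<in> {U. openin T U}"
  then have "openin S {x \<in> topspace S. f x \<in> U}"
    using assms by (auto intro: openin_continuous_map_preimage)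
  moreover have "f -` U \<inter> space (borel_of S) = {x \<in> topspace S. f x \<in> U}"
    by (auto simp: space_borel_of)
  ultimately show "f -` U \<inter> space (borel_of S) \<in> sets (borel_of S)"
    by (auto simp: sets_borel_of)
qed

lemma measurable_isomorphic_refl: "measurable_isomorphic M M"
  unfolding measurable_isomorphic_def by (intro exI[of _ "\<lambda>x. x"]) auto

lemma measurable_isomorphic_trans:
  assumes "measurable_isomorphic M N" "measurable_isomorphic N K"
  shows "measurable_isomorphic M K"
proof -
  obtain f g where fg: "f \<in> measurable M N" "g \<in> measurable N M"
      "\<forall>x\<in>space M. g (f x) = x" "\<forall>y\<in>space N. f (g y) = y"
    using assms(1) unfolding measurable_isomorphic_def by blast
  obtain h k where hk: "h \<in> measurable N K" "k \<in> measurable K N"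
      "\<forall>x\<in>space N. k (h x) = x" "\<forall>y\<in>space K. h (k y) = y"
    using assms(2) unfolding measurable_isomorphic_def by blast
  have "h \<circ> f \<in> measurable M K" "g \<circ> k \<in> measurable K M"
    using fg hk by (auto intro: measurable_comp)
  moreover have "\<forall>x\<in>space M. (g \<circ> k) ((h \<circ> f) x) = x" "\<forall>y\<in>space K. (h \<circ> f) ((g \<circ> k) y) = y"
    using fg hk by (auto dest: measurable_space)
  ultimately show ?thesis
    unfolding measurable_isomorphic_def by blast
qed

lemma polish_topology_inj_real:
  assumes "polish_topology (T :: 'a topology)"
  shows "\<exists>j :: 'a \<Rightarrow> real. inj_on j (topspace T)"
proof -
  obtain M d where M: "Metric_space M d" and T: "T = Metric_space.mtopology M d"
    using assms unfolding polish_topology_def completely_metrizable_space_def by blast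
  interpret Metric_space M d by (rule M)
  obtain C where C: "countable C" "C \<subseteq> M" "T closure_of C = M"
    using assms T unfolding polish_topology_def separable_space_def by auto
  define e :: "'a \<Rightarrow> (nat \<times> rat) set" where
    "e x = {(n, q). n \<in> to_nat_on C ` C \<and> d (from_nat_into C n) x < of_rat q}" for x
  have e: "inj_on e M"
  proof (rule inj_onI, rule ccontr)
    fix x y assume xy: "x \<in> M" "y \<in> M" "e x = e y" "x \<noteq> y"
    then have pos: "d x y / 2 > 0" by simp
    have "x \<in> mtopology closure_of C" using C T xy by simp
    then have "\<forall>r>0. \<exists>c\<in>C. c \<in> mball x r"
      unfolding metric_closure_of by simp
    then obtain c where "c \<in> C" "c \<in> mball x (d x y / 2)"
      using pos by blast
    then have c: "c \<in> C" "c \<in> M" "d x c < d x y / 2"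
      by simp_all
    then obtain q :: rat where q: "d x c < of_rat q" "of_rat q < d x y / 2"
      using of_rat_dense by blast
    have fc: "from_nat_into C (to_nat_on C c) = c"
      using c C by simp
    have "(to_nat_on C c, q) \<in> e x"
      using c q fc by (auto simp: e_def commute)
    then have "(to_nat_on C c, q) \<in> e y"
      using xy(3) by (simp only:)
    then have "d c y < of_rat q"
      using fc by (simp add: e_def)
    then have "d x y < d x y"
      using triangle[of x c y] xy c q by auto
    then show False by simp
  qed
  obtain h :: "nat \<times> rat \<Rightarrow> nat" where h: "inj h"
    using inj_to_nat by blast
  obtain k :: "nat set \<Rightarrow> real" where k: "inj k"
    using nat_sets_eqpoll_reals unfolding eqpoll_def bij_betw_def by blast
  have "inj_on (\<lambda>x. k (h ` e x)) M"
  proof (rule inj_onI)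
    fix x y assume xy: "x \<in> M" "y \<in> M" "k (h ` e x) = k (h ` e y)"
    have "h ` e x = h ` e y"
      using xy(3) by (rule injD[OF k])
    then have "e x = e y"
      using inj_image_eq_iff[OF h] by blast
    then show "x = y"
      using inj_onD[OF e] xy by blast
  qed
  then show ?thesis
    unfolding T topspace_mtopology by blast
qed

lemma standard_borelI:
  fixes T :: "'b topology"
  assumes T: "polish_topology T" and A: "A \<in> sets (borel_of T)"
    and M: "measurable_isomorphic M (restrict_space (borel_of T) A)"
  shows "standard_borel M"
proof -
  obtain j :: "'b \<Rightarrow> real" where j: "inj_on j (topspace T)"
    using polish_topology_inj_real[OF T] by blast
  define i where "i = inv_into (topspace T) j"
  define S where "S = pullback_topology (j ` topspace T) i T"
  have ij: "i (j x) = x" if "x \<in> topspace T" for x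
    using that j by (simp add: i_def)
  have topS: "topspace S = j ` topspace T"
    using ij by (auto simp: S_def topspace_pullback_topology)
  have ci: "continuous_map S T i"
    unfolding S_def using continuous_map_pullback[OF continuous_map_id] by simp
  have cj: "continuous_map T S j"
    unfolding S_def
  proof (rule continuous_map_pullback')
    show "continuous_map T T (i \<circ> j)"
      by (rule continuous_map_eq[OF continuous_map_id]) (simp add: ij)
  qed auto
  have "homeomorphic_maps T S j i"
    unfolding homeomorphic_maps_def using ci cj ij topS by auto
  then have "T homeomorphic_space S"
    unfolding homeomorphic_space_def by blast
  then have S: "polish_topology S"
    using T homeomorphic_completely_metrizable_space homeomorphic_separable_space
    unfolding polish_topology_def by blast
  have mi: "i \<in> measurable (borel_of S) (borel_of T)" and mj: "j \<in> measurable (borel_of T) (borel_of S)"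
    using ci cj by (auto intro: continuous_map_imp_measurable)
  define A' where "A' = i -` A \<inter> space (borel_of S)"
  have A': "A' \<in> sets (borel_of S)"
    unfolding A'_def using mi A by (rule measurable_sets)
  have AT: "A \<subseteq> topspace T"
    using sets.sets_into_space[OF A] by (simp add: space_borel_of)
  have "measurable_isomorphic (restrict_space (borel_of T) A) (restrict_space (borel_of S) A')"
    unfolding measurable_isomorphic_def
  proof (intro exI conjI ballI)
    show "j \<in> measurable (restrict_space (borel_of T) A) (restrict_space (borel_of S) A')"
      using mj AT ij topS
      by (intro measurable_restrict_space3) (auto simp: A'_def space_borel_of)
    show "i \<in> measurable (restrict_space (borel_of S) A') (restrict_space (borel_of T) A)"
      using mi by (intro measurable_restrict_space3) (auto simp: A'_def)
  qed (use ij topS AT in \<open>auto simp: space_restrict_space space_borel_of A'_def\<close>)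
  then show ?thesis
    unfolding standard_borel_def using S A' measurable_isomorphic_trans[OF M] by blast
qed

lemma analytic_inI:
  fixes N :: "'b measure"
  assumes N: "standard_borel N" and R: "R \<in> sets (M \<Otimes>\<^sub>M N)"
  shows "analytic_in M (fst ` R)"
proof -
  obtain T :: "real topology" and A where T: "polish_topology T" "A \<in> sets (borel_of T)"
      and iso: "measurable_isomorphic N (restrict_space (borel_of T) A)"
    using N unfolding standard_borel_def by blast
  define K where "K = restrict_space (borel_of T) A"
  have K: "standard_borel K"
    using standard_borelI[OF T measurable_isomorphic_refl] by (simp add: K_def)
  obtain f g where fg: "f \<in> measurable N K" "g \<in> measurable K N" "\<forall>x\<in>space N. g (f x) = x"
    using iso unfolding measurable_isomorphic_def K_def by blast
  define h where "h = (\<lambda>p. (fst p, g (snd p)) :: 'a \<times> 'b)"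
  have h: "h \<in> measurable (M \<Otimes>\<^sub>M K) (M \<Otimes>\<^sub>M N)"
    unfolding h_def using fg(2) by measurable
  define R' where "R' = h -` R \<inter> space (M \<Otimes>\<^sub>M K)"
  have R': "R' \<in> sets (M \<Otimes>\<^sub>M K)"
    unfolding R'_def using h R by (rule measurable_sets)
  have "fst ` R = fst ` R'"
  proof (intro equalityI subsetI)
    fix x assume "x \<in> fst ` R"
    then obtain y where xy: "(x, y) \<in> R" by auto
    then have "x \<in> space M" "y \<in> space N"
      using sets.sets_into_space[OF R] by (auto simp: space_pair_measure)
    then have "(x, f y) \<in> R'"
      using xy fg measurable_space[OF fg(1)] by (auto simp: R'_def h_def space_pair_measure)
    then show "x \<in> fst ` R'" by force
  next
    fix x assume "x \<in> fst ` R'"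
    then show "x \<in> fst ` R" by (force simp: R'_def h_def)
  qed
  then show ?thesis
    unfolding analytic_in_def using K R' by blast
qed

end

theory Submission
  imports Defs
begin

text \<open>
  Let \<open>y\<^sub>0\<close> be a point in the relative interior of the convex hull of \<open>Y\<close>, and for each \<open>x\<close> consider the
  convex cone generated by the points \<open>(y, 1, r)\<close> with \<open>r < f (x, y)\<close>; it depends analytically on \<open>x\<close>.
  The supremum of the \<open>r\<close> with \<open>(y\<^sub>0, 1, r)\<close> in the cone is finite, because some affine majorant exists,
  so Novikov's separation theorem for sequences of analytic sets yields a Borel function \<open>C\<close> above it.
  Subtracting \<open>C\<close> at \<open>y\<^sub>0\<close> leaves a cone whose domain is a linear subspace, by the choice of \<open>y\<^sub>0\<close>, and
  whose values at \<open>0\<close> are nonpositive. The slope \<open>B\<close> is then found one coordinate at a time as in the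
  Hahn--Banach theorem: the admissible values of a coordinate lie between a supremum with analytic
  superlevel sets and an infimum with analytic sublevel sets, and Lusin separation puts a Borel
  function in between.
\<close>

section \<open>Novikov separation in Polish spaces\<close>

text \<open>In a Polish space these are the analytic sets. A closed witness, rather than a Borel
  one, is what the nested-set argument in \<open>novikov_separation\<close> works with.\<close>

definition closed_projection :: "'a::topological_space set \<Rightarrow> bool" where
  "closed_projection S \<longleftrightarrow> (\<exists>C :: ('a \<times> (nat \<Rightarrow> real)) set. closed C \<and> S = fst ` C)"

lemma continuous_on_snd_coordinate:
  "continuous_on UNIV (\<lambda>z :: 'a::topological_space \<times> ('i \<Rightarrow> 'b::topological_space). snd z k)"
  by (rule continuous_on_compose2[OF continuous_on_product_coordinates[of k]
        continuous_on_snd[OF continuous_on_id]]) auto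

lemma closed_imp_closed_projection:
  assumes "closed S"
  shows "closed_projection S"
  unfolding closed_projection_def
  by (intro exI[of _ "S \<times> UNIV"] conjI closed_Times assms) auto

lemma closed_projection_UN:
  fixes S :: "nat \<Rightarrow> 'a::topological_space set"
  assumes "\<And>n. closed_projection (S n)"
  shows "closed_projection (\<Union>n. S n)"
proof -
  obtain C :: "nat \<Rightarrow> ('a \<times> (nat \<Rightarrow> real)) set" where C: "\<And>n. closed (C n)" "\<And>n. S n = fst ` C n"
    using assms unfolding closed_projection_def by metis
  define shift :: "'a \<times> (nat \<Rightarrow> real) \<Rightarrow> 'a \<times> (nat \<Rightarrow> real)"
    where "shift = (\<lambda>(x, \<sigma>). (x, \<lambda>k. \<sigma> (Suc k)))"
  \<comment> \<open>Entry \<open>0\<close> selects the index of the union. Distinct naturals are at distance at least \<open>1\<close>, so the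
    selected condition can be written as an intersection of closed conditions.\<close>
  define D where "D = {z. snd z 0 \<in> \<nat>} \<inter> (\<Inter>n. {z. 1 \<le> \<bar>snd z 0 - real n\<bar>} \<union> shift -` C n)"
  have shift: "continuous_on UNIV shift"
    unfolding shift_def case_prod_unfold
    by (intro continuous_intros continuous_on_coordinatewise_then_product continuous_on_snd_coordinate)
  have "closed D"
    unfolding D_def
  proof (intro closed_Int closed_INT ballI closed_Un)
    show "closed {z :: 'a \<times> (nat \<Rightarrow> real). snd z 0 \<in> \<nat>}"
      using closed_vimage[OF closed_Nats continuous_on_snd_coordinate[of 0]] by (simp add: vimage_def)
    show "closed {z :: 'a \<times> (nat \<Rightarrow> real). 1 \<le> \<bar>snd z 0 - real n\<bar>}" for n
      by (intro closed_Collect_le continuous_intros continuous_on_snd_coordinate)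
    show "closed (shift -` C n)" for n
      by (rule closed_vimage[OF C(1) shift])
  qed
  moreover have "(\<Union>n. S n) = fst ` D"
  proof (intro equalityI subsetI)
    fix x assume "x \<in> (\<Union>n. S n)"
    then obtain n \<sigma> where n: "(x, \<sigma>) \<in> C n" using C(2) by auto
    define \<tau> where "\<tau> = (\<lambda>k. case k of 0 \<Rightarrow> real n | Suc j \<Rightarrow> \<sigma> j)"
    have "1 \<le> \<bar>real n - real m\<bar> \<or> m = n" for m by linarith
    then have "(x, \<tau>) \<in> D" using n by (fastforce simp: D_def \<tau>_def shift_def)
    then show "x \<in> fst ` D" by force
  next
    fix x assume "x \<in> fst ` D"
    then obtain \<tau> where "(x, \<tau>) \<in> D" by auto
    moreover from this obtain n where "\<tau> 0 = real n" by (auto simp: D_def elim: Nats_cases)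
    ultimately have "shift (x, \<tau>) \<in> C n" by (auto simp: D_def dest: spec[of _ n])
    then show "x \<in> (\<Union>n. S n)" using C(2) by (force simp: shift_def)
  qed
  ultimately show ?thesis unfolding closed_projection_def by blast
qed

text \<open>One real sequence can carry a witness for every index at once:
  \<open>prod_encode\<close> arranges it as a matrix whose row \<open>n\<close> is the witness for
  \<open>S n\<close>, and each row depends continuously on the sequence.\<close>

lemma closed_projection_INT:
  fixes S :: "nat \<Rightarrow> 'a::topological_space set"
  assumes "\<And>n. closed_projection (S n)"
  shows "closed_projection (\<Inter>n. S n)"
proof -
  obtain C :: "nat \<Rightarrow> ('a \<times> (nat \<Rightarrow> real)) set" where C: "\<And>n. closed (C n)" "\<And>n. S n = fst ` C n"
    using assms unfolding closed_projection_def by metis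
  define row :: "nat \<Rightarrow> 'a \<times> (nat \<Rightarrow> real) \<Rightarrow> 'a \<times> (nat \<Rightarrow> real)"
    where "row n = (\<lambda>(x, \<sigma>). (x, \<lambda>k. \<sigma> (prod_encode (n, k))))" for n
  have "continuous_on UNIV (row n)" for n
    unfolding row_def case_prod_unfold
    by (intro continuous_intros continuous_on_coordinatewise_then_product continuous_on_snd_coordinate)
  then have "closed (\<Inter>n. row n -` C n)"
    using closed_vimage[OF C(1)] by blast
  moreover have "(\<Inter>n. S n) = fst ` (\<Inter>n. row n -` C n)"
  proof (intro equalityI subsetI)
    fix x assume "x \<in> (\<Inter>n. S n)"
    then have "\<forall>n. \<exists>\<sigma>. (x, \<sigma>) \<in> C n" using C(2) by fastforce
    then obtain \<sigma> where \<sigma>: "\<And>n. (x, \<sigma> n) \<in> C n" by metis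
    define \<tau> where "\<tau> = (\<lambda>j. case prod_decode j of (n, k) \<Rightarrow> \<sigma> n k)"
    have "(x, \<tau>) \<in> (\<Inter>n. row n -` C n)" using \<sigma> by (simp add: row_def \<tau>_def)
    then show "x \<in> fst ` (\<Inter>n. row n -` C n)" by force
  next
    fix x assume "x \<in> fst ` (\<Inter>n. row n -` C n)"
    then obtain \<tau> where "\<And>n. row n (x, \<tau>) \<in> C n" by fastforce
    then have "x \<in> fst ` C n" for n unfolding row_def by (metis case_prod_conv fst_conv imageI)
    then show "x \<in> (\<Inter>n. S n)" using C(2) by auto
  qed
  ultimately show ?thesis unfolding closed_projection_def by blast
qed

text \<open>Projections of closed sets need not be stable under complements, so the induction over
  the generated sigma-algebra treats a set together with its complement. Open sets enter as
  countable unions of closed sets, which is available in metric spaces.\<close>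

lemma borel_imp_closed_projection:
  fixes S :: "'a::{metric_space, second_countable_topology} set"
  assumes "S \<in> sets borel"
  shows "closed_projection S"
proof -
  have "S \<in> sigma_sets UNIV {S. open S}"
    using assms by (simp add: sets_borel)
  then have "closed_projection S \<and> closed_projection (- S)"
  proof (induction rule: sigma_sets.induct)
    case (Basic U)
    then have "open U" by simp
    then have "fsigma_in euclidean U"
      using open_imp_fsigma_in[OF metrizable_space_euclidean, of U] by simp
    then obtain F :: "nat \<Rightarrow> 'a set" where "\<And>n. closed (F n)" "U = (\<Union>n. F n)"
      unfolding fsigma_in_ascending by auto
    then show ?case
      using closed_projection_UN[of F] closed_imp_closed_projection \<open>open U\<close>
      by (metis closed_Compl)
  next
    case Empty
    then show ?case by (simp add: closed_imp_closed_projection)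
  next
    case (Compl a)
    then show ?case by (simp add: Compl_eq_Diff_UNIV[symmetric])
  next
    case (Union a)
    then show ?case
      using closed_projection_UN[of a] closed_projection_INT[of "\<lambda>n. - a n"] by simp
  qed
  then show ?thesis ..
qed

section \<open>Borel separation of sequences of sets\<close>

definition borel_separable :: "(nat \<Rightarrow> 'a::topological_space set) \<Rightarrow> bool" where
  "borel_separable S \<longleftrightarrow> (\<exists>B. (\<forall>n. B n \<in> sets borel \<and> S n \<subseteq> B n) \<and> (\<Inter>n. B n) = {})"

text \<open>Separating families for all the pieces are glued by taking the union over
  \<open>j\<close> at index \<open>k\<close> and the intersection over \<open>j\<close> at every
  other index. The contrapositive is what matters later: if a sequence is not separable, some piece
  of its entry \<open>k\<close> keeps it so.\<close>

lemma borel_separable_UN: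
  fixes S :: "nat \<Rightarrow> 'a::topological_space set" and P :: "nat \<Rightarrow> 'a set"
  assumes "\<And>j. borel_separable (S(k := P j))" and "S k \<subseteq> (\<Union>j. P j)"
  shows "borel_separable S"
proof -
  obtain B where B: "\<And>j n. B j n \<in> sets borel" "\<And>j n. (S(k := P j)) n \<subseteq> B j n"
      "\<And>j. (\<Inter>n. B j n) = {}"
    using assms(1) unfolding borel_separable_def by metis
  define A where "A n = (if n = k then \<Union>j. B j k else \<Inter>j. B j n)" for n
  have "A n \<in> sets borel" for n
    using B(1) by (auto simp: A_def)
  moreover have "S n \<subseteq> A n" for n
    using B(2)[of _ n] assms(2) by (fastforce simp: A_def)
  moreover have "(\<Inter>n. A n) = {}"
  proof (rule ccontr)
    assume "(\<Inter>n. A n) \<noteq> {}"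
    then obtain x where x: "\<And>n. x \<in> A n" by auto
    then obtain j where "x \<in> B j k" using x[of k] by (auto simp: A_def)
    then have "x \<in> B j n" for n using x[of n] by (cases "n = k") (auto simp: A_def)
    then show False using B(3)[of j] by blast
  qed
  ultimately show ?thesis unfolding borel_separable_def by blast
qed

lemma countable_closed_small_cover:
  fixes e :: real
  assumes "0 < e"
  shows "\<exists>P :: nat \<Rightarrow> 'w::{metric_space, second_countable_topology} set.
    (\<Union>j. P j) = UNIV \<and> (\<forall>j. closed (P j) \<and> (\<forall>x\<in>P j. \<forall>y\<in>P j. dist x y < e))"
proof -
  obtain D :: "'w set" where D: "countable D" "\<And>U. open U \<Longrightarrow> U \<noteq> {} \<Longrightarrow> \<exists>d\<in>D. d \<in> U"
    using countable_dense_setE by blast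
  then have "D \<noteq> {}" using D(2)[of UNIV] by auto
  \<comment> \<open>Closed balls of radius \<open>e/3\<close> around dense centres cover the space,
    and two points of one ball are at distance at most \<open>2*e/3\<close>, strictly below
    \<open>e\<close>.\<close>
  define P where "P j = cball (from_nat_into D j) (e/3)" for j
  have "x \<in> (\<Union>j. P j)" for x
  proof -
    obtain d where "d \<in> D" "d \<in> ball x (e/3)" using D(2)[of "ball x (e/3)"] assms by auto
    moreover then obtain j where "d = from_nat_into D j"
      using D(1) \<open>D \<noteq> {}\<close> by (metis from_nat_into_surj)
    ultimately show ?thesis by (auto simp: P_def dist_commute intro!: exI[of _ j])
  qed
  moreover have "dist x y < e" if "x \<in> P j" "y \<in> P j" for x y j
    using that dist_triangle3[of x y "from_nat_into D j"] assms by (auto simp: P_def)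
  ultimately show ?thesis by (intro exI[of _ P]) (auto simp: P_def)
qed

text \<open>Suppose there is no separation. By \<open>borel_separable_UN\<close> a nonseparable
  sequence stays nonseparable when one entry is cut down to a suitable small closed piece, so
  repeated refinement and completeness shrink every entry to a single point. The images of these
  points under \<open>h\<close> must agree, and the common value contradicts
  \<open>empty\<close>.\<close>

theorem novikov_separation:
  fixes C :: "nat \<Rightarrow> 'w::{complete_space, second_countable_topology} set"
    and h :: "'w \<Rightarrow> 'a::t2_space"
  assumes closed: "\<And>n. closed (C n)" and cont: "continuous_on UNIV h"
    and empty: "(\<Inter>n. h ` C n) = {}"
  shows "borel_separable (\<lambda>n. h ` C n)"
proof (rule ccontr)
  assume nsep: "\<not> ?thesis"
  define good where
    "good D \<longleftrightarrow> (\<forall>n. closed (D n)) \<and> \<not> borel_separable (\<lambda>n. h ` D n)" for D :: "nat \<Rightarrow> 'w set"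
  define small where
    "small e S \<longleftrightarrow> (\<forall>x\<in>S. \<forall>y\<in>S. dist x y < e)" for e and S :: "'w set"
  have step: "\<exists>E. good E \<and> (\<forall>n. E n \<subseteq> D n) \<and> small e (E k)"
    if D: "good D" and "0 < e" for D k e
  proof -
    obtain P :: "nat \<Rightarrow> 'w set" where P: "(\<Union>j. P j) = UNIV" "\<And>j. closed (P j)" "\<And>j. small e (P j)"
      unfolding small_def using countable_closed_small_cover[OF \<open>0 < e\<close>] by metis
    have "\<exists>j. \<not> borel_separable ((\<lambda>n. h ` D n)(k := h ` (D k \<inter> P j)))"
    proof (rule ccontr)
      assume "\<not> ?thesis"
      then have "borel_separable ((\<lambda>n. h ` D n)(k := h ` (D k \<inter> P j)))" for j by blast
      moreover have "h ` D k \<subseteq> (\<Union>j. h ` (D k \<inter> P j))" using P(1) by blast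
      ultimately have "borel_separable (\<lambda>n. h ` D n)"
        by (rule borel_separable_UN)
      then show False using D by (simp add: good_def)
    qed
    then obtain j where j: "\<not> borel_separable ((\<lambda>n. h ` D n)(k := h ` (D k \<inter> P j)))" ..
    have "(\<lambda>n. h ` (D(k := D k \<inter> P j)) n) = (\<lambda>n. h ` D n)(k := h ` (D k \<inter> P j))"
      by (rule ext) simp
    then have "good (D(k := D k \<inter> P j))" using j D P(2) by (auto simp: good_def)
    moreover have "small e ((D(k := D k \<inter> P j)) k)" using P(3) by (auto simp: small_def)
    ultimately show ?thesis by (intro exI[of _ "D(k := D k \<inter> P j)"]) auto
  qed
  \<comment> \<open>Every index is refined at infinitely many stages.\<close>
  define idx :: "nat \<Rightarrow> nat" where "idx m = fst (prod_decode m)" for m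
  obtain F where F0: "F 0 = C" and F: "\<And>m. good (F m)" "\<And>m n. F (Suc m) n \<subseteq> F m n"
      "\<And>m. small (1 / Suc m) (F (Suc m) (idx m))"
  proof -
    \<comment> \<open>Dependent choice leaves the initial value open, so the invariant carries it as
      a condition on stage \<open>0\<close>.\<close>
    have "\<exists>F. \<forall>m. (good (F m) \<and> (m = 0 \<longrightarrow> F m = C)) \<and>
        ((\<forall>n. F (Suc m) n \<subseteq> F m n) \<and> small (1 / Suc m) (F (Suc m) (idx m)))"
    proof (rule dependent_nat_choice[where P = "\<lambda>m D. good D \<and> (m = 0 \<longrightarrow> D = C)"
          and Q = "\<lambda>m D E. (\<forall>n. E n \<subseteq> D n) \<and> small (1 / Suc m) (E (idx m))"])
      show "\<exists>D. good D \<and> (0 = 0 \<longrightarrow> D = C)" using nsep closed by (auto simp: good_def)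
      show "\<exists>E. (good E \<and> (Suc m = 0 \<longrightarrow> E = C)) \<and>
          (\<forall>n. E n \<subseteq> D n) \<and> small (1 / Suc m) (E (idx m))"
        if "good D \<and> (m = 0 \<longrightarrow> D = C)" for D m
        using step[of D "1 / Suc m" "idx m"] that by auto
    qed
    then show ?thesis using that by blast
  qed
  have mono: "F m' n \<subseteq> F m n" if "m \<le> m'" for m m' n
    using that by (induction rule: dec_induct) (use F(2) in auto)
  have ne: "F m n \<noteq> {}" for m n
  proof
    assume "F m n = {}"
    then have "borel_separable (\<lambda>n. h ` F m n)"
      unfolding borel_separable_def by (intro exI[of _ "(\<lambda>_. UNIV)(n := {})"]) auto
    then show False using F(1) by (simp add: good_def)
  qed
  have shrink: "\<exists>m. small e (F m n)" if "0 < e" for e n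
  proof -
    obtain j :: nat where j: "1 / Suc j < e" using \<open>0 < e\<close> nat_approx_posE by blast
    \<comment> \<open>Stage \<open>m\<close> refines index \<open>n\<close>, and
      \<open>j \<le> m\<close> makes its diameter bound at most \<open>1 / Suc j\<close>.\<close>
    define m where "m = prod_encode (n, j)"
    have "j \<le> m" unfolding m_def by (rule le_prod_encode_2)
    then have "1 / real (Suc m) \<le> 1 / real (Suc j)" by (simp add: frac_le)
    moreover have "small (1 / Suc m) (F (Suc m) n)"
      using F(3)[of m] by (simp add: idx_def m_def)
    ultimately show ?thesis using j unfolding small_def by (intro exI[of _ "Suc m"]) fastforce
  qed
  have "\<exists>a. (\<Inter>m. F m n) = {a}" for n
    using F(1) ne mono shrink unfolding good_def small_def
    by (intro decreasing_closed_nest_sing) auto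
  then obtain z where z: "\<And>n. (\<Inter>m. F m n) = {z n}" by metis
  then have zF: "z n \<in> F m n" for m n by blast
  have nbhd: "\<exists>m. h ` F m n \<subseteq> U" if U: "open U" "h (z n) \<in> U" for U n
  proof -
    have "open (h -` U)" using cont U(1) by (simp add: open_vimage)
    then obtain e where e: "0 < e" "ball (z n) e \<subseteq> h -` U"
      using U(2) open_contains_ball by (metis vimageI)
    obtain m where "small e (F m n)" using shrink e(1) by blast
    then have "F m n \<subseteq> ball (z n) e" using zF by (auto simp: small_def)
    then show ?thesis using e(2) by blast
  qed
  \<comment> \<open>Otherwise disjoint neighbourhoods of the two limit values, with the whole space
    at all other indices, would separate a late stage of the refinement.\<close>
  have "h (z n) = h (z 0)" for n
  proof (rule ccontr)
    assume neq: "h (z n) \<noteq> h (z 0)"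
    then obtain U V where UV: "open U" "open V" "h (z n) \<in> U" "h (z 0) \<in> V" "U \<inter> V = {}"
      using hausdorff by metis
    obtain a b where "h ` F a n \<subseteq> U" "h ` F b 0 \<subseteq> V" using nbhd UV by metis
    then have ab: "h ` F (max a b) n \<subseteq> U" "h ` F (max a b) 0 \<subseteq> V"
      using mono[of a "max a b" n] mono[of b "max a b" 0] by fastforce+
    have "n \<noteq> 0" using neq by metis
    define B where "B = (\<lambda>_. UNIV)(n := U, 0 := V)"
    have "(\<Inter>k. B k) \<subseteq> B n \<inter> B 0" by blast
    then have "(\<Inter>k. B k) = {}" using UV(5) \<open>n \<noteq> 0\<close> by (auto simp: B_def)
    moreover have "B k \<in> sets borel \<and> h ` F (max a b) k \<subseteq> B k" for k
      using ab UV by (auto simp: B_def)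
    ultimately have "borel_separable (\<lambda>k. h ` F (max a b) k)"
      unfolding borel_separable_def by blast
    then show False using F(1) by (simp add: good_def)
  qed
  moreover have "z n \<in> C n" for n using zF[of n 0] F0 by simp
  ultimately have "h (z 0) \<in> (\<Inter>n. h ` C n)" by (metis INT_I imageI)
  then show False using empty by simp
qed

section \<open>Standard Borel spaces as Borel sets of real sequences\<close>

text \<open>A point is coded by its distances to a dense sequence. The code determines the point,
  and the set of codes is cut out by countably many closed and open conditions on the
  coordinates.\<close>

lemma polish_topology_isomorphic_sequences:
  fixes T :: "'a topology"
  assumes "polish_topology T"
  shows "\<exists>E :: (nat \<Rightarrow> real) set. E \<in> sets borel \<and>
    measurable_isomorphic (borel_of T) (restrict_space borel E)"
proof (cases "topspace T = {}")
  case True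
  show ?thesis
    by (intro exI[of _ "{}"] conjI)
      (auto simp: measurable_isomorphic_def space_borel_of True space_restrict_space measurable_def
        sets_restrict_space)
next
  case False
  obtain M d where M: "Metric_space M d" "Metric_space.mcomplete M d"
    and T: "T = Metric_space.mtopology M d"
    using assms unfolding polish_topology_def completely_metrizable_space_def by blast
  interpret Metric_space M d by (rule M)
  have top: "topspace T = M" by (simp add: T)
  obtain D where D: "countable D" "D \<subseteq> M" "T closure_of D = M"
    using assms T unfolding polish_topology_def separable_space_def by auto
  then have "D \<noteq> {}" using False top by auto
  define c where "c = from_nat_into D"
  have cD: "range c = D" unfolding c_def by (rule range_from_nat_into[OF \<open>D \<noteq> {}\<close> D(1)])
  then have cM: "c i \<in> M" for i using D(2) by blast
  have dense: "\<exists>i. d (c i) x < r" if x: "x \<in> M" "0 < r" for x r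
  proof -
    have "x \<in> mtopology closure_of D" using D(3) T x by simp
    then obtain y where "y \<in> D" "y \<in> mball x r" using x(2) unfolding metric_closure_of by blast
    then show ?thesis using cD by (metis commute in_mball rangeE)
  qed
  define e where "e x = (\<lambda>i. d (c i) x)" for x
  \<comment> \<open>By completeness, \<open>E\<close> is exactly the set of distance sequences of points of the space.\<close>
  define E where "E = {\<tau>. (\<forall>i j. d (c i) (c j) \<le> \<tau> i + \<tau> j \<and> \<tau> i \<le> \<tau> j + d (c i) (c j)) \<and>
    (\<forall>k. \<exists>j. \<tau> j < 1 / Suc k)}"
  have eE: "e x \<in> E" if "x \<in> M" for x
    unfolding E_def e_def
  proof (intro CollectI conjI allI)
    show "d (c i) (c j) \<le> d (c i) x + d (c j) x" for i j
      using triangle[of "c i" x "c j"] cM that by (simp add: commute)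
    show "d (c i) x \<le> d (c j) x + d (c i) (c j)" for i j
      using triangle[of "c i" "c j" x] cM that by simp
    show "\<exists>j. d (c j) x < 1 / Suc k" for k
      by (rule dense[OF that]) simp
  qed
  have Ee: "\<exists>x\<in>M. e x = \<tau>" if \<tau>E: "\<tau> \<in> E" for \<tau>
  proof -
    have tri: "d (c i) (c j) \<le> \<tau> i + \<tau> j" "\<tau> i \<le> \<tau> j + d (c i) (c j)" for i j
      using \<tau>E by (auto simp: E_def)
    have "\<forall>k. \<exists>j. \<tau> j < 1 / Suc k" using \<tau>E by (simp add: E_def)
    then obtain s where s: "\<And>k. \<tau> (s k) < 1 / Suc k" by metis
    have s_small: "\<exists>N. \<forall>n\<ge>N. \<tau> (s n) < \<epsilon>" if "0 < \<epsilon>" for \<epsilon>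
    proof -
      obtain N :: nat where N: "1 / Suc N < \<epsilon>" using \<open>0 < \<epsilon>\<close> nat_approx_posE by blast
      have "\<tau> (s n) < \<epsilon>" if "N \<le> n" for n
      proof -
        have "1 / real (Suc n) \<le> 1 / real (Suc N)" using that by (simp add: frac_le)
        then show ?thesis using s[of n] N by linarith
      qed
      then show ?thesis by blast
    qed
    \<comment> \<open>The upper bound on \<open>d (c i) (c j)\<close> makes the centres
      \<open>c (s k)\<close> a Cauchy sequence; both bounds together then force the distances from
      its limit to the centres to be the entries of \<tau>.\<close>
    have "MCauchy (\<lambda>k. c (s k))"
      unfolding MCauchy_def
    proof (intro conjI allI impI)
      show "range (\<lambda>k. c (s k)) \<subseteq> M" using cM by auto
      fix \<epsilon> :: real assume "0 < \<epsilon>"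
      then obtain N where N: "\<And>n. N \<le> n \<Longrightarrow> \<tau> (s n) < \<epsilon> / 2" using s_small[of "\<epsilon> / 2"] by auto
      have "d (c (s n)) (c (s n')) < \<epsilon>" if "N \<le> n" "N \<le> n'" for n n'
        using tri(1)[of "s n" "s n'"] N[OF that(1)] N[OF that(2)] by linarith
      then show "\<exists>N. \<forall>n n'. N \<le> n \<longrightarrow> N \<le> n' \<longrightarrow> d (c (s n)) (c (s n')) < \<epsilon>" by blast
    qed
    then obtain x where x: "limitin mtopology (\<lambda>k. c (s k)) x sequentially"
      using M(2) unfolding mcomplete_def by blast
    then have xM: "x \<in> M" by (rule limitin_mspace)
    have "d (c i) x = \<tau> i" for i
    proof (rule ccontr)
      assume "d (c i) x \<noteq> \<tau> i"
      then have pos: "0 < \<bar>d (c i) x - \<tau> i\<bar> / 2" by simp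
      then obtain N where N: "\<And>n. N \<le> n \<Longrightarrow> \<tau> (s n) < \<bar>d (c i) x - \<tau> i\<bar> / 2"
        using s_small by blast
      obtain N' where N': "\<And>n. N' \<le> n \<Longrightarrow> d (c (s n)) x < \<bar>d (c i) x - \<tau> i\<bar> / 2"
        using x pos unfolding limit_metric_sequentially by meson
      define n where "n = max N N'"
      have "d (c i) x \<le> d (c i) (c (s n)) + d (c (s n)) x" "d (c i) (c (s n)) \<le> d (c i) x + d (c (s n)) x"
        using triangle[of "c i" "c (s n)" x] triangle[of "c i" x "c (s n)"] cM xM
        by (simp_all add: commute)
      moreover have "d (c i) (c (s n)) \<le> \<tau> i + \<tau> (s n)" "\<tau> i \<le> \<tau> (s n) + d (c i) (c (s n))"
        by (rule tri)+
      moreover have "\<tau> (s n) < \<bar>d (c i) x - \<tau> i\<bar> / 2" "d (c (s n)) x < \<bar>d (c i) x - \<tau> i\<bar> / 2"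
        using N N' by (auto simp: n_def)
      ultimately have "d (c i) x - \<tau> i \<le> \<tau> (s n) + d (c (s n)) x" "\<tau> i - d (c i) x \<le> \<tau> (s n) + d (c (s n)) x"
          "\<tau> (s n) + d (c (s n)) x < \<bar>d (c i) x - \<tau> i\<bar>"
        by argo+
      then show False by (auto simp: abs_if split: if_splits)
    qed
    then show ?thesis using xM by (auto simp: e_def)
  qed
  have inj: "x = y" if "x \<in> M" "y \<in> M" "e x = e y" for x y
  proof (rule ccontr)
    assume "x \<noteq> y"
    then have "0 < d x y / 2" using that by simp
    then obtain i where "d (c i) x < d x y / 2" using dense \<open>x \<in> M\<close> by blast
    moreover have "d (c i) x = d (c i) y" using that(3) by (metis e_def)
    ultimately show False using triangle[of x "c i" y] that cM by (simp add: commute)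
  qed
  define g where "g \<tau> = (THE x. x \<in> M \<and> e x = \<tau>)" for \<tau>
  have g: "g \<tau> \<in> M" "e (g \<tau>) = \<tau>" if "\<tau> \<in> E" for \<tau>
  proof -
    have "\<exists>!x. x \<in> M \<and> e x = \<tau>" using Ee[OF that] inj by blast
    from theI'[OF this] show "g \<tau> \<in> M" "e (g \<tau>) = \<tau>" by (simp_all add: g_def)
  qed
  have ge: "g (e x) = x" if "x \<in> M" for x using g[OF eE[OF that]] inj that by blast
  have E_eq: "E = (\<Inter>i. \<Inter>j. {\<tau>. d (c i) (c j) \<le> \<tau> i + \<tau> j} \<inter> {\<tau>. \<tau> i \<le> \<tau> j + d (c i) (c j)}) \<inter>
      (\<Inter>k. \<Union>j. {\<tau>. \<tau> j < 1 / Suc k})"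
    unfolding E_def by auto
  have open_less: "open {\<tau> :: nat \<Rightarrow> real. \<tau> j < a}" for j a
    by (intro open_Collect_less continuous_on_const continuous_on_product_coordinates)
  have closed_le: "closed {\<tau> :: nat \<Rightarrow> real. a \<le> \<tau> i + \<tau> j}" "closed {\<tau> :: nat \<Rightarrow> real. \<tau> i \<le> \<tau> j + a}" for i j a
    by (intro closed_Collect_le continuous_on_add continuous_on_const continuous_on_product_coordinates)+
  have E: "E \<in> sets borel"
    unfolding E_eq
    by (intro sets.Int sets.countable_INT'' sets.countable_UN'' borel_closed[OF closed_le(1)]
        borel_closed[OF closed_le(2)] borel_open[OF open_less]) auto
  have "e \<in> borel_measurable (borel_of T)"
  proof (rule measurable_coordinatewise_then_product)
    show "(\<lambda>x. e x i) \<in> borel_measurable (borel_of T)" for i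
      unfolding borel_measurable_iff_less
    proof
      fix a
      have "{w \<in> space (borel_of T). e w i < a} = mball (c i) a"
        using cM by (auto simp: space_borel_of top e_def)
      also have "\<dots> \<in> sets (borel_of T)"
        unfolding sets_borel_of T by (intro sigma_sets.Basic) simp
      finally show "{w \<in> space (borel_of T). e w i < a} \<in> sets (borel_of T)" .
    qed
  qed
  then have e_meas: "e \<in> measurable (borel_of T) (restrict_space borel E)"
    using eE by (intro measurable_restrict_space2) (auto simp: space_borel_of top)
  have g_meas: "g \<in> measurable (restrict_space borel E) (borel_of T)"
    unfolding borel_of_def
  proof (rule measurable_measure_of)
    show "{U. openin T U} \<subseteq> Pow (topspace T)" by (auto dest: openin_subset)
    show "g \<in> space (restrict_space borel E) \<rightarrow> topspace T"
      using g top by (auto simp: space_restrict_space)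
    fix U assume "U \<in> {U. openin T U}"
    then have U: "U \<subseteq> M" "\<And>x. x \<in> U \<Longrightarrow> \<exists>r>0. mball x r \<subseteq> U"
      unfolding T openin_mtopology by auto
    \<comment> \<open>The set \<open>U\<close> is the union of the countably many basic balls that
      it contains. Through the coding, the ball around \<open>c i\<close> of radius
      \<open>1 / Suc k\<close> becomes a strict inequality on coordinate \<open>i\<close>.\<close>
    define J where "J = {(i, k :: nat). mball (c i) (1 / Suc k) \<subseteq> U}"
    have "g -` U \<inter> space (restrict_space borel E) = E \<inter> (\<Union>(i, k)\<in>J. {\<tau>. \<tau> i < 1 / Suc k})"
    proof (intro equalityI subsetI)
      fix \<tau> assume "\<tau> \<in> g -` U \<inter> space (restrict_space borel E)"
      then have \<tau>: "\<tau> \<in> E" "g \<tau> \<in> U" by (auto simp: space_restrict_space)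
      obtain r where r: "0 < r" "mball (g \<tau>) r \<subseteq> U" using U(2) \<tau>(2) by blast
      obtain k :: nat where k: "1 / Suc k < r / 2" using r(1) nat_approx_posE[of "r / 2"] by auto
      have "0 < 1 / real (Suc k)" by simp
      from dense[OF g(1)[OF \<tau>(1)] this] obtain i where i: "d (c i) (g \<tau>) < 1 / Suc k" ..
      have "y \<in> mball (g \<tau>) r" if "y \<in> mball (c i) (1 / Suc k)" for y
      proof -
        have "y \<in> M" "d (c i) y < 1 / Suc k" using that by auto
        then show ?thesis
          using triangle[of "g \<tau>" "c i" y] i k g(1)[OF \<tau>(1)] cM[of i] commute[of "c i" "g \<tau>"] by simp
      qed
      then have "(i, k) \<in> J" using r(2) unfolding J_def by blast
      moreover have "\<tau> i < 1 / Suc k" using i g(2)[OF \<tau>(1)] by (metis e_def)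
      ultimately show "\<tau> \<in> E \<inter> (\<Union>(i, k)\<in>J. {\<tau>. \<tau> i < 1 / Suc k})" using \<tau>(1) by blast
    next
      fix \<tau> assume "\<tau> \<in> E \<inter> (\<Union>(i, k)\<in>J. {\<tau>. \<tau> i < 1 / Suc k})"
      then obtain i k where \<tau>: "\<tau> \<in> E" "mball (c i) (1 / Suc k) \<subseteq> U" "\<tau> i < 1 / Suc k"
        by (auto simp: J_def)
      then have "d (c i) (g \<tau>) < 1 / Suc k" using g(2)[OF \<tau>(1)] by (metis e_def)
      then have "g \<tau> \<in> U" using \<tau>(2) g(1)[OF \<tau>(1)] cM[of i] by (auto simp: in_mball)
      then show "\<tau> \<in> g -` U \<inter> space (restrict_space borel E)"
        using \<tau>(1) by (simp add: space_restrict_space)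
    qed
    moreover have "(\<Union>(i, k)\<in>J. {\<tau> :: nat \<Rightarrow> real. \<tau> i < 1 / Suc k}) \<in> sets borel"
      by (intro sets.countable_UN'') (auto simp: split_beta intro!: borel_open open_less)
    ultimately show "g -` U \<inter> space (restrict_space borel E) \<in> sets (restrict_space borel E)"
      using E by (simp add: sets_restrict_space_iff)
  qed
  show ?thesis
    unfolding measurable_isomorphic_def
    using E e_meas g_meas g ge
    by (intro exI[of _ E] conjI exI[of _ e] exI[of _ g]) (auto simp: space_borel_of top space_restrict_space)
qed

lemma measurable_isomorphic_restrict_space:
  assumes "measurable_isomorphic M N" and A: "A \<in> sets M"
  shows "\<exists>A'\<in>sets N. measurable_isomorphic (restrict_space M A) (restrict_space N A')"
proof -
  obtain f g where fg: "f \<in> measurable M N" "g \<in> measurable N M"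
      "\<forall>x\<in>space M. g (f x) = x" "\<forall>y\<in>space N. f (g y) = y"
    using assms(1) unfolding measurable_isomorphic_def by blast
  define A' where "A' = g -` A \<inter> space N"
  have A': "A' \<in> sets N" unfolding A'_def using fg(2) A by (rule measurable_sets)
  have AM: "A \<subseteq> space M" by (rule sets.sets_into_space[OF A])
  have "f \<in> measurable (restrict_space M A) (restrict_space N A')"
    using fg AM by (intro measurable_restrict_space3) (auto simp: A'_def dest: measurable_space)
  moreover have "g \<in> measurable (restrict_space N A') (restrict_space M A)"
    using fg by (intro measurable_restrict_space3) (auto simp: A'_def)
  ultimately show ?thesis
    using A' fg unfolding measurable_isomorphic_def
    by (intro bexI[of _ A'] exI[of _ f] exI[of _ g]) (auto simp: space_restrict_space A'_def)
qed

lemma standard_borel_isomorphic_sequences: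
  fixes N :: "'a measure"
  assumes "standard_borel N"
  shows "\<exists>E :: (nat \<Rightarrow> real) set. E \<in> sets borel \<and> measurable_isomorphic N (restrict_space borel E)"
proof -
  obtain T :: "real topology" and A where T: "polish_topology T" and A: "A \<in> sets (borel_of T)"
    and N: "measurable_isomorphic N (restrict_space (borel_of T) A)"
    using assms unfolding standard_borel_def by blast
  obtain E :: "(nat \<Rightarrow> real) set" where E: "E \<in> sets borel"
    and iso: "measurable_isomorphic (borel_of T) (restrict_space borel E)"
    using polish_topology_isomorphic_sequences[OF T] by blast
  obtain A' where A': "A' \<in> sets (restrict_space borel E)"
    and iso': "measurable_isomorphic (restrict_space (borel_of T) A)
      (restrict_space (restrict_space borel E) A')"
    using measurable_isomorphic_restrict_space[OF iso A] by blast
  have "A' \<subseteq> E" "A' \<in> sets borel" using A' E by (auto simp: sets_restrict_space_iff)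
  then have "restrict_space (restrict_space borel E) A' = restrict_space borel A'"
    using E by (simp add: restrict_restrict_space Int_absorb1)
  then have "measurable_isomorphic N (restrict_space borel A')"
    using measurable_isomorphic_trans[OF N iso'] by simp
  then show ?thesis using \<open>A' \<in> sets borel\<close> by blast
qed

section \<open>Analytic subsets of measurable spaces\<close>

lemma standard_borel_borel:
  "standard_borel (borel :: 'b::{complete_space, second_countable_topology} measure)"
proof -
  have "separable_space (euclidean :: 'b topology)"
  proof -
    obtain D :: "'b set" where D: "countable D" "\<And>U. open U \<Longrightarrow> U \<noteq> {} \<Longrightarrow> \<exists>d\<in>D. d \<in> U"
      using countable_dense_setE by blast
    then have "- closure D = {}" using D(2)[of "- closure D"] closure_subset[of D] by blast
    then have "euclidean closure_of D = UNIV" by auto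
    then show ?thesis using D(1) unfolding separable_space_def by auto
  qed
  then have "polish_topology (euclidean :: 'b topology)"
    by (simp add: polish_topology_def completely_metrizable_space_euclidean)
  moreover have "borel_of euclidean = (borel :: 'b measure)"
    by (simp add: borel_of_def borel_def)
  moreover have "measurable_isomorphic (borel :: 'b measure) (restrict_space (borel :: 'b measure) UNIV)"
    unfolding measurable_isomorphic_def
    by (intro exI[of _ "\<lambda>x :: 'b. x"] conjI measurable_restrict_space1 measurable_restrict_space2) auto
  ultimately show ?thesis
    using standard_borelI[of "euclidean :: 'b topology" UNIV borel] by simp
qed

text \<open>The inverse \<phi> of the coding is provided on all sequences, so that preimages under
  it can be formed in the full product space.\<close>

lemma standard_borel_image_sequences:
  assumes "standard_borel N" and "space N \<noteq> {}"
  shows "\<exists>E e \<phi>. E \<in> sets (borel :: (nat \<Rightarrow> real) measure) \<and> e \<in> measurable N borel \<and>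
    \<phi> \<in> measurable borel N \<and> (\<forall>x\<in>space N. e x \<in> E \<and> \<phi> (e x) = x) \<and> (\<forall>\<tau>\<in>E. e (\<phi> \<tau>) = \<tau>)"
proof -
  obtain E :: "(nat \<Rightarrow> real) set" and e g where E: "E \<in> sets borel"
    and e: "e \<in> measurable N (restrict_space borel E)" and g: "g \<in> measurable (restrict_space borel E) N"
    and inv: "\<forall>x\<in>space N. g (e x) = x" "\<forall>\<tau>\<in>space (restrict_space borel E). e (g \<tau>) = \<tau>"
    using standard_borel_isomorphic_sequences[OF assms(1)] unfolding measurable_isomorphic_def by blast
  \<comment> \<open>The point \<open>x0\<close> is the default value of the inverse outside
    \<open>E\<close>; here nonemptiness of \<open>space N\<close> is used.\<close>
  obtain x0 where "x0 \<in> space N" using assms(2) by blast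
  then have "(\<lambda>\<tau>. if \<tau> \<in> E then g \<tau> else x0) \<in> measurable borel N"
    using g E by (subst measurable_restrict_space_iff[symmetric]) auto
  moreover have "e \<in> measurable N borel" "e \<in> space N \<rightarrow> E"
    using e by (auto simp: measurable_restrict_space2_iff)
  ultimately show ?thesis
    using E inv by (intro exI[of _ E] exI[of _ e] exI[of _ "\<lambda>\<tau>. if \<tau> \<in> E then g \<tau> else x0"])
      (auto simp: space_restrict_space)
qed

text \<open>Fixing one parameter space for all analytic sets lets witnesses of different sets be
  combined without carrying along the standard Borel spaces they came from.\<close>

lemma analytic_in_iff_sequences:
  "analytic_in M S \<longleftrightarrow> (\<exists>R \<in> sets (M \<Otimes>\<^sub>M (borel :: (nat \<Rightarrow> real) measure)). S = fst ` R)"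
proof
  assume "analytic_in M S"
  then obtain N :: "real measure" and R
    where N: "standard_borel N" and R: "R \<in> sets (M \<Otimes>\<^sub>M N)" and S: "S = fst ` R"
    unfolding analytic_in_def by blast
  have sub: "R \<subseteq> space M \<times> space N"
    using sets.sets_into_space[OF R] by (simp add: space_pair_measure)
  show "\<exists>R \<in> sets (M \<Otimes>\<^sub>M (borel :: (nat \<Rightarrow> real) measure)). S = fst ` R"
  proof (cases "space N = {}")
    case True
    then show ?thesis using sub S by auto
  next
    case False
    obtain e \<phi> where \<phi>: "\<phi> \<in> measurable (borel :: (nat \<Rightarrow> real) measure) N"
      and inv: "\<forall>x\<in>space N. \<phi> (e x) = x"
      using standard_borel_image_sequences[OF N False] by blast
    define R' where "R' = (\<lambda>z. (fst z, \<phi> (snd z))) -` R \<inter> space (M \<Otimes>\<^sub>M borel)"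
    have "R' \<in> sets (M \<Otimes>\<^sub>M borel)"
      unfolding R'_def by (rule measurable_sets[OF _ R]) (use \<phi> in measurable)
    moreover have "S = fst ` R'"
    proof (intro equalityI subsetI)
      fix x assume "x \<in> S"
      then obtain y where xy: "(x, y) \<in> R" using S by auto
      then have "(x, e y) \<in> R'" using inv sub by (auto simp: R'_def space_pair_measure)
      then show "x \<in> fst ` R'" by force
    next
      fix x assume "x \<in> fst ` R'"
      then show "x \<in> S" using S by (force simp: R'_def)
    qed
    ultimately show ?thesis by blast
  qed
next
  assume "\<exists>R \<in> sets (M \<Otimes>\<^sub>M (borel :: (nat \<Rightarrow> real) measure)). S = fst ` R"
  then show "analytic_in M S" using analytic_inI[OF standard_borel_borel] by blast
qed

lemma analytic_in_subset_space:
  assumes "analytic_in M S"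
  shows "S \<subseteq> space M"
  using assms unfolding analytic_in_def
  by (auto dest!: sets.sets_into_space simp: space_pair_measure)

section \<open>Closure properties of analytic sets\<close>

lemma analytic_in_sets:
  assumes "A \<in> sets M"
  shows "analytic_in M A"
  unfolding analytic_in_iff_sequences
  by (intro bexI[of _ "A \<times> UNIV"]) (use assms in auto)

lemma analytic_in_vimage:
  assumes h: "h \<in> measurable M M'" and "analytic_in M' S"
  shows "analytic_in M (h -` S \<inter> space M)"
proof -
  obtain R where R: "R \<in> sets (M' \<Otimes>\<^sub>M (borel :: (nat \<Rightarrow> real) measure))" "S = fst ` R"
    using assms(2) unfolding analytic_in_iff_sequences by blast
  define R' where "R' = (\<lambda>z. (h (fst z), snd z)) -` R \<inter> space (M \<Otimes>\<^sub>M borel)"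
  have "R' \<in> sets (M \<Otimes>\<^sub>M borel)"
    unfolding R'_def by (rule measurable_sets[OF _ R(1)]) (use h in measurable)
  moreover have "h -` S \<inter> space M = fst ` R'"
  proof (intro equalityI subsetI)
    fix x assume x: "x \<in> h -` S \<inter> space M"
    then obtain \<tau> where "(h x, \<tau>) \<in> R" using R(2) by auto
    then have "(x, \<tau>) \<in> R'" using x by (simp add: R'_def space_pair_measure)
    then show "x \<in> fst ` R'" by force
  qed (use R(2) in \<open>force simp: R'_def space_pair_measure\<close>)
  ultimately show ?thesis unfolding analytic_in_iff_sequences by blast
qed

lemma analytic_in_UN:
  fixes S :: "'i::countable \<Rightarrow> 'a set"
  assumes "\<And>i. analytic_in M (S i)"
  shows "analytic_in M (\<Union>i. S i)"
proof -
  obtain R where R: "\<And>i. R i \<in> sets (M \<Otimes>\<^sub>M (borel :: (nat \<Rightarrow> real) measure))" "\<And>i. S i = fst ` R i"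
    using assms unfolding analytic_in_iff_sequences by metis
  have "(\<Union>i. R i) \<in> sets (M \<Otimes>\<^sub>M borel)"
    using R(1) by (intro sets.countable_UN'') auto
  moreover have "(\<Union>i. S i) = fst ` (\<Union>i. R i)" using R(2) by auto
  ultimately show ?thesis unfolding analytic_in_iff_sequences by blast
qed

text \<open>A point of the intersection is witnessed by a pair of sequences, and the space of such
  pairs is again Polish.\<close>

lemma analytic_in_Int:
  assumes "analytic_in M S" "analytic_in M S'"
  shows "analytic_in M (S \<inter> S')"
proof -
  obtain R R' where R: "R \<in> sets (M \<Otimes>\<^sub>M (borel :: (nat \<Rightarrow> real) measure))" "S = fst ` R"
    and R': "R' \<in> sets (M \<Otimes>\<^sub>M (borel :: (nat \<Rightarrow> real) measure))" "S' = fst ` R'"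
    using assms unfolding analytic_in_iff_sequences by blast
  define N where "N = (borel :: (nat \<Rightarrow> real) measure) \<Otimes>\<^sub>M (borel :: (nat \<Rightarrow> real) measure)"
  define Q where "Q = ((\<lambda>z. (fst z, fst (snd z))) -` R \<inter> space (M \<Otimes>\<^sub>M N)) \<inter>
    ((\<lambda>z. (fst z, snd (snd z))) -` R' \<inter> space (M \<Otimes>\<^sub>M N))"
  have "Q \<in> sets (M \<Otimes>\<^sub>M N)"
    unfolding Q_def N_def
    by (intro sets.Int measurable_sets[OF _ R(1)] measurable_sets[OF _ R'(1)]) measurable
  moreover have "standard_borel N" unfolding N_def borel_prod by (rule standard_borel_borel)
  moreover have "S \<inter> S' = fst ` Q"
  proof (intro equalityI subsetI)
    fix x assume "x \<in> S \<inter> S'"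
    then obtain \<sigma> \<tau> where st: "(x, \<sigma>) \<in> R" "(x, \<tau>) \<in> R'" using R(2) R'(2) by auto
    then have "x \<in> space M" using sets.sets_into_space[OF R(1)] by (auto simp: space_pair_measure)
    then have "(x, (\<sigma>, \<tau>)) \<in> Q" using st by (simp add: Q_def N_def space_pair_measure)
    then show "x \<in> fst ` Q" by force
  qed (use R(2) R'(2) in \<open>force simp: Q_def\<close>)
  ultimately show ?thesis using analytic_inI by metis
qed

lemma analytic_in_fst:
  fixes S :: "('a \<times> 'b::{complete_space, second_countable_topology}) set"
  assumes "analytic_in (M \<Otimes>\<^sub>M borel) S"
  shows "analytic_in M (fst ` S)"
proof -
  obtain R where R: "R \<in> sets ((M \<Otimes>\<^sub>M (borel :: 'b measure)) \<Otimes>\<^sub>M (borel :: (nat \<Rightarrow> real) measure))"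
      "S = fst ` R"
    using assms unfolding analytic_in_iff_sequences by blast
  define N where "N = (borel :: 'b measure) \<Otimes>\<^sub>M (borel :: (nat \<Rightarrow> real) measure)"
  define Q where "Q = (\<lambda>z. ((fst z, fst (snd z)), snd (snd z))) -` R \<inter> space (M \<Otimes>\<^sub>M N)"
  have "Q \<in> sets (M \<Otimes>\<^sub>M N)"
    unfolding Q_def N_def by (rule measurable_sets[OF _ R(1)]) measurable
  moreover have "standard_borel N" unfolding N_def borel_prod by (rule standard_borel_borel)
  moreover have "fst ` S = fst ` Q"
  proof (intro equalityI subsetI)
    fix x assume "x \<in> fst ` S"
    then obtain y \<tau> where st: "((x, y), \<tau>) \<in> R" using R(2) by auto
    then have "x \<in> space M" using sets.sets_into_space[OF R(1)] by (auto simp: space_pair_measure)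
    then have "(x, (y, \<tau>)) \<in> Q" using st by (simp add: Q_def N_def space_pair_measure)
    then show "x \<in> fst ` Q" by force
  qed (use R(2) in \<open>force simp: Q_def\<close>)
  ultimately show ?thesis using analytic_inI by metis
qed

text \<open>Together with the rules that follow, this lets analyticity be read off the logical form
  of a condition: conjunctions, countable existentials, existentials over Polish types, and
  membership after a measurable substitution.\<close>

lemma analytic_in_Collect_conj:
  assumes "analytic_in M {x \<in> space M. P x}" "analytic_in M {x \<in> space M. Q x}"
  shows "analytic_in M {x \<in> space M. P x \<and> Q x}"
proof -
  have "{x \<in> space M. P x \<and> Q x} = {x \<in> space M. P x} \<inter> {x \<in> space M. Q x}" by auto
  then show ?thesis using analytic_in_Int[OF assms] by simp
qed

lemma analytic_in_Collect_ex_countable: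
  fixes P :: "'i::countable \<Rightarrow> 'a \<Rightarrow> bool"
  assumes "\<And>i. analytic_in M {x \<in> space M. P i x}"
  shows "analytic_in M {x \<in> space M. \<exists>i. P i x}"
proof -
  have "{x \<in> space M. \<exists>i. P i x} = (\<Union>i. {x \<in> space M. P i x})" by auto
  then show ?thesis using analytic_in_UN[OF assms] by simp
qed

lemma analytic_in_Collect_ex:
  fixes P :: "'a \<Rightarrow> 'b::{complete_space, second_countable_topology} \<Rightarrow> bool"
  assumes "analytic_in (M \<Otimes>\<^sub>M borel) {z \<in> space (M \<Otimes>\<^sub>M borel). P (fst z) (snd z)}"
  shows "analytic_in M {x \<in> space M. \<exists>y. P x y}"
proof -
  have "{x \<in> space M. \<exists>y. P x y} = fst ` {z \<in> space (M \<Otimes>\<^sub>M borel). P (fst z) (snd z)}"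
    by (force simp: space_pair_measure)
  then show ?thesis using analytic_in_fst[OF assms] by simp
qed

lemma analytic_in_Collect_mem:
  assumes "h \<in> measurable M M'" "analytic_in M' S"
  shows "analytic_in M {x \<in> space M. h x \<in> S}"
  using analytic_in_vimage[OF assms] by (simp add: vimage_def Int_def conj_commute)

text \<open>The coding \<open>e\<close> carries the sets to images of closed sets in a Polish space,
  where \<open>novikov_separation\<close> applies; the Borel sets found there are pulled back along
  \<open>e\<close>.\<close>

theorem analytic_in_novikov_separation:
  fixes X :: "'a measure" and A :: "nat \<Rightarrow> 'a set"
  assumes X: "standard_borel X" and A: "\<And>n. analytic_in X (A n)" and empty: "(\<Inter>n. A n) = {}"
  shows "\<exists>B. (\<forall>n. B n \<in> sets X \<and> A n \<subseteq> B n) \<and> (\<Inter>n. B n) = {}"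
proof (cases "space X = {}")
  case True
  then have "A n = {}" for n using analytic_in_subset_space[OF A[of n]] by simp
  then show ?thesis by (intro exI[of _ "\<lambda>_. {}"]) simp
next
  case False
  obtain E e \<phi> where E: "E \<in> sets (borel :: (nat \<Rightarrow> real) measure)"
    and e: "e \<in> measurable X borel" and \<phi>: "\<phi> \<in> measurable borel X"
    and e\<phi>: "\<And>x. x \<in> space X \<Longrightarrow> e x \<in> E" "\<And>x. x \<in> space X \<Longrightarrow> \<phi> (e x) = x" "\<And>\<tau>. \<tau> \<in> E \<Longrightarrow> e (\<phi> \<tau>) = \<tau>"
    using standard_borel_image_sequences[OF X False] by blast
  obtain R where R: "\<And>n. R n \<in> sets (X \<Otimes>\<^sub>M (borel :: (nat \<Rightarrow> real) measure))" "\<And>n. A n = fst ` R n"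
    using A unfolding analytic_in_iff_sequences by metis
  \<comment> \<open>Nothing is known about \<phi> outside \<open>E\<close>, so sequences that code
    no point have to be removed explicitly.\<close>
  have "(E \<times> UNIV) \<inter> ((\<lambda>z. (\<phi> (fst z), snd z)) -` R n \<inter> space (borel \<Otimes>\<^sub>M borel))
      \<in> sets ((borel :: (nat \<Rightarrow> real) measure) \<Otimes>\<^sub>M (borel :: (nat \<Rightarrow> real) measure))" for n
    by (intro sets.Int pair_measureI E measurable_sets[OF _ R(1)]) (use \<phi> in measurable)
  then have "closed_projection ((E \<times> UNIV) \<inter> (\<lambda>z. (\<phi> (fst z), snd z)) -` R n)" for n
    unfolding borel_prod by (intro borel_imp_closed_projection) simp
  then obtain C :: "nat \<Rightarrow> (((nat \<Rightarrow> real) \<times> (nat \<Rightarrow> real)) \<times> (nat \<Rightarrow> real)) set"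
    where C: "\<And>n. closed (C n)" "\<And>n. (E \<times> UNIV) \<inter> (\<lambda>z. (\<phi> (fst z), snd z)) -` R n = fst ` C n"
    unfolding closed_projection_def by metis
  \<comment> \<open>Two auxiliary sequences are projected away: one witnesses membership in
    \<open>A n\<close>, the other comes from writing a Borel set as the projection of a closed
    one.\<close>
  have image: "(fst \<circ> fst) ` C n = e ` A n" for n
  proof -
    have "(fst \<circ> fst) ` C n = fst ` ((E \<times> UNIV) \<inter> (\<lambda>z. (\<phi> (fst z), snd z)) -` R n)"
      unfolding C(2) by (simp add: image_comp)
    also have "\<dots> = e ` A n"
    proof (intro equalityI subsetI)
      fix \<sigma> assume "\<sigma> \<in> fst ` ((E \<times> UNIV) \<inter> (\<lambda>z. (\<phi> (fst z), snd z)) -` R n)"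
      then have "\<sigma> \<in> E" "\<phi> \<sigma> \<in> A n" using R(2)[of n] by force+
      then show "\<sigma> \<in> e ` A n" using e\<phi>(3) by (metis imageI)
    next
      fix \<sigma> assume "\<sigma> \<in> e ` A n"
      then obtain x \<tau> where x: "\<sigma> = e x" "(x, \<tau>) \<in> R n" using R(2)[of n] by auto
      then have "x \<in> space X" using sets.sets_into_space[OF R(1)[of n]] by (auto simp: space_pair_measure)
      then have "(\<sigma>, \<tau>) \<in> (E \<times> UNIV) \<inter> (\<lambda>z. (\<phi> (fst z), snd z)) -` R n" using x e\<phi> by simp
      then show "\<sigma> \<in> fst ` ((E \<times> UNIV) \<inter> (\<lambda>z. (\<phi> (fst z), snd z)) -` R n)" by force
    qed
    finally show ?thesis .
  qed
  have "(\<Inter>n. (fst \<circ> fst) ` C n) = {}"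
  proof (rule ccontr)
    assume "(\<Inter>n. (fst \<circ> fst) ` C n) \<noteq> {}"
    then obtain \<sigma> where \<sigma>: "\<And>n. \<sigma> \<in> e ` A n" unfolding image by blast
    have "\<phi> \<sigma> \<in> A n" for n
      using \<sigma>[of n] e\<phi>(2) analytic_in_subset_space[OF A[of n]] by (metis imageE subsetD)
    then show False using empty by blast
  qed
  then have "borel_separable (\<lambda>n. (fst \<circ> fst) ` C n)"
    by (intro novikov_separation C(1))
      (auto simp: o_def intro!: continuous_on_fst continuous_on_id)
  then obtain B where B: "\<And>n. B n \<in> sets borel" "\<And>n. e ` A n \<subseteq> B n" "(\<Inter>n. B n) = {}"
    unfolding borel_separable_def image by blast
  show ?thesis
  proof (intro exI[of _ "\<lambda>n. e -` B n \<inter> space X"] conjI allI)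
    show "e -` B n \<inter> space X \<in> sets X" for n using e B(1) by (rule measurable_sets)
    show "A n \<subseteq> e -` B n \<inter> space X" for n
      using B(2)[of n] analytic_in_subset_space[OF A[of n]] by blast
    show "(\<Inter>n. e -` B n \<inter> space X) = {}" using B(3) by blast
  qed
qed

text \<open>Novikov separation is applied to the sequence \<open>A\<close>, \<open>A'\<close>,
  \<open>A'\<close>, and so on. As \<open>A'\<close> lies in every later Borel set, its part in the
  first one lies in the empty intersection.\<close>

corollary analytic_in_lusin_separation:
  assumes "standard_borel X" "analytic_in X A" "analytic_in X A'" "A \<inter> A' = {}"
  shows "\<exists>E\<in>sets X. A \<subseteq> E \<and> E \<inter> A' = {}"
proof -
  define S where "S n = (if n = 0 then A else A')" for n :: nat
  have "(\<Inter>n. S n) \<subseteq> S 0 \<inter> S 1" by blast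
  then have "(\<Inter>n. S n) = {}" using assms(4) by (simp add: S_def)
  moreover have "analytic_in X (S n)" for n using assms(2,3) by (simp add: S_def)
  ultimately obtain B where B: "\<And>n. B n \<in> sets X" "\<And>n. S n \<subseteq> B n" "(\<Inter>n. B n) = {}"
    using analytic_in_novikov_separation[OF assms(1), of S] by blast
  have "B 0 \<inter> A' \<subseteq> B n" for n using B(2)[of n] by (cases "n = 0") (auto simp: S_def)
  then have "B 0 \<inter> A' = {}" using B(3) by blast
  then show ?thesis using B(1,2)[of 0] by (auto simp: S_def)
qed

section \<open>Measurable selections between analytic sets and conic hulls\<close>

definition pos_comb :: "'w::real_vector set \<Rightarrow> 'w set" where
  "pos_comb S = {a *\<^sub>R (w + w') | a w w'. 0 < a \<and> w \<in> S \<and> w' \<in> S}"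

text \<open>This is the convex cone of strictly positive combinations, so the origin is not added by
  force. Building it as a countable union of iterates of one binary operation makes analyticity easy
  to follow.\<close>

definition pos_hull :: "'w::real_vector set \<Rightarrow> 'w set" where
  "pos_hull S = (\<Union>m. (pos_comb ^^ m) S)"

lemma pos_combI:
  assumes "0 < a" "w \<in> S" "w' \<in> S"
  shows "a *\<^sub>R (w + w') \<in> pos_comb S"
  using assms unfolding pos_comb_def by blast

lemma subset_pos_comb: "S \<subseteq> pos_comb S"
proof
  fix w assume "w \<in> S"
  then have "(1/2) *\<^sub>R (w + w) \<in> pos_comb S" by (intro pos_combI) simp_all
  then show "w \<in> pos_comb S" by (simp flip: scaleR_2)
qed

lemma pos_comb_power_mono:
  assumes "m \<le> n"
  shows "(pos_comb ^^ m) S \<subseteq> (pos_comb ^^ n) S"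
  using assms
proof (induction rule: dec_induct)
  case (step k)
  then show ?case using subset_pos_comb[of "(pos_comb ^^ k) S"] by simp
qed simp

lemma subset_pos_hull: "S \<subseteq> pos_hull S"
  unfolding pos_hull_def by (rule subsetI, rule UN_I[of 0]) simp_all

lemma pos_hull_comb:
  assumes "0 < a" "w \<in> pos_hull S" "w' \<in> pos_hull S"
  shows "a *\<^sub>R (w + w') \<in> pos_hull S"
proof -
  obtain m n where mn: "w \<in> (pos_comb ^^ m) S" "w' \<in> (pos_comb ^^ n) S"
    using assms unfolding pos_hull_def by blast
  have "w \<in> (pos_comb ^^ max m n) S" "w' \<in> (pos_comb ^^ max m n) S"
    using mn pos_comb_power_mono[of m "max m n" S] pos_comb_power_mono[of n "max m n" S] by auto
  then have "a *\<^sub>R (w + w') \<in> (pos_comb ^^ Suc (max m n)) S"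
    using assms(1) by (simp add: pos_combI)
  then show ?thesis unfolding pos_hull_def by blast
qed

lemma pos_hull_add:
  assumes "w \<in> pos_hull S" "w' \<in> pos_hull S"
  shows "w + w' \<in> pos_hull S"
  using pos_hull_comb[OF _ assms, of 1] by simp

lemma pos_hull_scaleR:
  assumes "0 < a" "w \<in> pos_hull S"
  shows "a *\<^sub>R w \<in> pos_hull S"
  using pos_hull_comb[of "a / 2", OF _ assms(2,2)] assms(1) by (simp flip: scaleR_2)

lemma pos_hull_subset:
  assumes "S \<subseteq> T" and add: "\<And>w w'. w \<in> T \<Longrightarrow> w' \<in> T \<Longrightarrow> w + w' \<in> T"
    and scale: "\<And>a w. 0 < a \<Longrightarrow> w \<in> T \<Longrightarrow> a *\<^sub>R w \<in> T"
  shows "pos_hull S \<subseteq> T"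
proof -
  have "(pos_comb ^^ m) S \<subseteq> T" for m
  proof (induction m)
    case (Suc m)
    then show ?case
      using add scale unfolding funpow.simps comp_apply pos_comb_def[of "(pos_comb ^^ m) S"] by blast
  qed (use assms(1) in simp)
  then show ?thesis unfolding pos_hull_def by blast
qed

text \<open>The hull is taken fibre by fibre. Each iterate arises from the previous one by
  quantifying over two of its points and a positive real, and analytic sets are stable under such
  quantifiers.\<close>

lemma analytic_in_pos_hull:
  fixes G :: "('a \<times> 'w::euclidean_space) set"
  assumes G: "analytic_in (M \<Otimes>\<^sub>M borel) G"
  shows "analytic_in (M \<Otimes>\<^sub>M borel)
    {z \<in> space (M \<Otimes>\<^sub>M borel). snd z \<in> pos_hull {w. (fst z, w) \<in> G}}"
proof -
  define H where "H m = {z \<in> space (M \<Otimes>\<^sub>M borel). snd z \<in> (pos_comb ^^ m) {w. (fst z, w) \<in> G}}" for m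
  have Gsp: "G \<subseteq> space (M \<Otimes>\<^sub>M borel)" by (rule analytic_in_subset_space[OF G])
  have "analytic_in (M \<Otimes>\<^sub>M borel) (H m)" for m
  proof (induction m)
    case 0
    have "H 0 = G" using Gsp by (auto simp: H_def)
    then show ?case using G by simp
  next
    case (Suc m)
    have "H (Suc m) = {z \<in> space (M \<Otimes>\<^sub>M borel). \<exists>w w' a. (0 < a \<and> snd z = a *\<^sub>R (w + w')) \<and>
        (fst z, w) \<in> H m \<and> (fst z, w') \<in> H m}"
      by (auto simp: H_def pos_comb_def space_pair_measure) blast+
    moreover have "analytic_in (M \<Otimes>\<^sub>M borel) \<dots>"
      by (intro analytic_in_Collect_ex analytic_in_Collect_conj analytic_in_Collect_mem[OF _ Suc.IH];
          (rule analytic_in_sets)?; measurable)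
    ultimately show ?case by simp
  qed
  then have "analytic_in (M \<Otimes>\<^sub>M borel) (\<Union>m. H m)" by (rule analytic_in_UN)
  moreover have "(\<Union>m. H m) = {z \<in> space (M \<Otimes>\<^sub>M borel). snd z \<in> pos_hull {w. (fst z, w) \<in> G}}"
    by (auto simp: H_def pos_hull_def)
  ultimately show ?thesis by simp
qed

text \<open>For each rational \<open>q\<close>, Lusin separation puts a Borel set \<open>E q\<close>
  between the points where the supremum of the \<open>U\<close>-fibre exceeds \<open>q\<close> and
  those where the infimum of the \<open>L\<close>-fibre is below \<open>q\<close>. The supremum of
  the \<open>q\<close> with \<open>x\<close> in \<open>E q\<close> then lies between the two
  bounds.\<close>

lemma borel_function_between_analytic:
  fixes U L :: "('a \<times> real) set"
  assumes X: "standard_borel X"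
    and U: "analytic_in (X \<Otimes>\<^sub>M borel) U" and L: "analytic_in (X \<Otimes>\<^sub>M borel) L"
    and le: "\<And>x r s. (x, r) \<in> U \<Longrightarrow> (x, s) \<in> L \<Longrightarrow> r \<le> s"
    and dom: "\<And>x. (\<exists>r. (x, r) \<in> U) \<longleftrightarrow> (\<exists>s. (x, s) \<in> L)"
  shows "\<exists>t \<in> borel_measurable X. (\<forall>(x, r)\<in>U. r \<le> t x) \<and> (\<forall>(x, s)\<in>L. t x \<le> s)"
proof -
  define V where "V q = {x \<in> space X. \<exists>r. of_rat q < r \<and> (x, r) \<in> U}" for q :: rat
  define W where "W q = {x \<in> space X. \<exists>s. s < of_rat q \<and> (x, s) \<in> L}" for q :: rat
  have "\<exists>E\<in>sets X. V q \<subseteq> E \<and> E \<inter> W q = {}" for q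
  proof (rule analytic_in_lusin_separation[OF X])
    show "analytic_in X (V q)"
      unfolding V_def
      by (intro analytic_in_Collect_ex analytic_in_Collect_conj analytic_in_Collect_mem[OF _ U])
        (auto intro!: analytic_in_sets)
    show "analytic_in X (W q)"
      unfolding W_def
      by (intro analytic_in_Collect_ex analytic_in_Collect_conj analytic_in_Collect_mem[OF _ L])
        (auto intro!: analytic_in_sets)
    show "V q \<inter> W q = {}" using le by (force simp: V_def W_def)
  qed
  then obtain E where E: "\<And>q. E q \<in> sets X" "\<And>q. V q \<subseteq> E q" "\<And>q. E q \<inter> W q = {}" by metis
  define T where "T x = (SUP q. if x \<in> E q then ereal (of_rat q) else - \<infinity>)" for x
  have [measurable]: "T \<in> borel_measurable X"
    unfolding T_def by (intro borel_measurable_SUP measurable_If_set) (use E(1) in auto)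
  have lower: "ereal r \<le> T x" if "(x, r) \<in> U" for x r
  proof (rule ccontr)
    assume "\<not> ereal r \<le> T x"
    then obtain p where p: "T x < ereal p" "p < r"
      using ereal_dense2[of "T x" "ereal r"] by (auto simp: not_le)
    then obtain q :: rat where q: "p < of_rat q" "of_rat q < r" using of_rat_dense by blast
    have "x \<in> space X" using analytic_in_subset_space[OF U] \<open>(x, r) \<in> U\<close> by (auto simp: space_pair_measure)
    then have "x \<in> V q" using q(2) \<open>(x, r) \<in> U\<close> by (auto simp: V_def)
    then have "ereal (of_rat q) \<le> T x"
      using E(2) unfolding T_def by (intro SUP_upper2[of q]) auto
    then have "ereal (of_rat q) < ereal p" using p(1) by (rule le_less_trans)
    then show False using q(1) by simp
  qed
  have upper: "T x \<le> ereal s" if "(x, s) \<in> L" for x s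
    unfolding T_def
  proof (rule SUP_least)
    fix q
    have "x \<in> space X" using analytic_in_subset_space[OF L] that by (auto simp: space_pair_measure)
    then have "of_rat q \<le> s" if "x \<in> E q"
      using E(3)[of q] \<open>(x, s) \<in> L\<close> that by (force simp: W_def)
    then show "(if x \<in> E q then ereal (of_rat q) else - \<infinity>) \<le> ereal s" by simp
  qed
  \<comment> \<open>By \<open>dom\<close> the fibres of \<open>U\<close> and \<open>L\<close> are
    nonempty over the same points, and there \<open>T\<close> is squeezed between two reals.
    Elsewhere the value of \<open>real_of_ereal\<close> is unconstrained.\<close>
  have real_T: "ereal (real_of_ereal (T x)) = T x" if "(x, r) \<in> U" "(x, s) \<in> L" for x r s
    using lower[OF that(1)] upper[OF that(2)] by (cases "T x") auto
  show ?thesis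
  proof (intro bexI[of _ "\<lambda>x. real_of_ereal (T x)"] conjI ballI)
    show "(\<lambda>x. real_of_ereal (T x)) \<in> borel_measurable X" by measurable
    show "case z of (x, r) \<Rightarrow> r \<le> real_of_ereal (T x)" if "z \<in> U" for z
    proof -
      obtain x r where z: "z = (x, r)" by (cases z)
      then obtain s where "(x, s) \<in> L" using dom \<open>z \<in> U\<close> by blast
      then show ?thesis using real_T[of x r s] lower[of x r] that unfolding z
        by (metis (mono_tags) case_prod_conv ereal_less_eq(3))
    qed
    show "case z of (x, s) \<Rightarrow> real_of_ereal (T x) \<le> s" if "z \<in> L" for z
    proof -
      obtain x s where z: "z = (x, s)" by (cases z)
      then obtain r where "(x, r) \<in> U" using dom \<open>z \<in> L\<close> by blast
      then show ?thesis using real_T[of x r s] upper[of x s] that unfolding z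
        by (metis (mono_tags) case_prod_conv ereal_less_eq(3))
    qed
  qed
qed

section \<open>A Borel Hahn--Banach theorem\<close>

text \<open>Each fibre of \<open>K\<close> lists lower bounds for a superlinear function whose
  domain, when nonempty, is a linear subspace by \<open>add\<close>, \<open>scale\<close> and
  \<open>sym\<close>. The set \<open>J\<close> holds the coordinates still to be treated; the
  induction fixes the slope along one of them and passes to the quotient by that direction.\<close>

theorem borel_linear_majorant_on:
  fixes K :: "('a \<times> ('v::euclidean_space \<times> real)) set"
  assumes X: "standard_borel X" and J: "finite J" "J \<subseteq> Basis"
    and K: "analytic_in (X \<Otimes>\<^sub>M borel) K"
    and add: "\<And>x p p'. (x, p) \<in> K \<Longrightarrow> (x, p') \<in> K \<Longrightarrow> (x, p + p') \<in> K"
    and scale: "\<And>x p a. 0 < a \<Longrightarrow> (x, p) \<in> K \<Longrightarrow> (x, a *\<^sub>R p) \<in> K"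
    and sym: "\<And>x w r. (x, (w, r)) \<in> K \<Longrightarrow> \<exists>s. (x, (- w, s)) \<in> K"
    and zero: "\<And>x r. (x, (0, r)) \<in> K \<Longrightarrow> r \<le> 0"
    and supp: "\<And>x w r i. (x, (w, r)) \<in> K \<Longrightarrow> i \<in> Basis - J \<Longrightarrow> w \<bullet> i = 0"
  shows "\<exists>B \<in> borel_measurable X. \<forall>x w r. (x, (w, r)) \<in> K \<longrightarrow> r \<le> B x \<bullet> w"
  using J K add scale sym zero supp
proof (induction J arbitrary: K rule: finite_induct)
  case empty
  have "r \<le> 0 \<bullet> w" if "(x, (w, r)) \<in> K" for x w r
  proof -
    have "w = 0" by (rule euclidean_eqI) (simp add: empty.prems(7)[OF that])
    then show ?thesis using empty.prems(6) that by simp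
  qed
  then show ?case by (intro bexI[of _ "\<lambda>_. 0"]) auto
next
  case (insert e J)
  note K = insert.prems(2) and add = insert.prems(3) and scale = insert.prems(4)
    and sym = insert.prems(5) and zero = insert.prems(6) and supp = insert.prems(7)
  have e: "e \<in> Basis" using insert.prems(1) by simp
  have Ksp: "x \<in> space X" if "(x, p) \<in> K" for x p
    using analytic_in_subset_space[OF K] that by (auto simp: space_pair_measure)
  \<comment> \<open>A slope \<open>t\<close> along \<open>e\<close> has to satisfy
    \<open>r \<le> t\<close> for the bounds at \<open>e\<close> and \<open>t \<le> s\<close> for the
    bounds at \<open>- e\<close>. By \<open>sym\<close> the two families are empty at the same
    points.\<close>
  define U where "U = {z \<in> space (X \<Otimes>\<^sub>M borel). (fst z, (e, snd z)) \<in> K}"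
  define L where "L = {z \<in> space (X \<Otimes>\<^sub>M borel). (fst z, (- e, - snd z)) \<in> K}"
  have U_iff: "(x, r) \<in> U \<longleftrightarrow> (x, (e, r)) \<in> K" for x r
    using Ksp by (auto simp: U_def space_pair_measure)
  have L_iff: "(x, s) \<in> L \<longleftrightarrow> (x, (- e, - s)) \<in> K" for x s
    using Ksp by (auto simp: L_def space_pair_measure)
  have "\<exists>t \<in> borel_measurable X. (\<forall>(x, r)\<in>U. r \<le> t x) \<and> (\<forall>(x, s)\<in>L. t x \<le> s)"
  proof (rule borel_function_between_analytic[OF X])
    show "analytic_in (X \<Otimes>\<^sub>M borel) U"
      unfolding U_def by (rule analytic_in_Collect_mem[OF _ K]) measurable
    show "analytic_in (X \<Otimes>\<^sub>M borel) L"
      unfolding L_def by (rule analytic_in_Collect_mem[OF _ K]) measurable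
    show "r \<le> s" if "(x, r) \<in> U" "(x, s) \<in> L" for x r s
      using zero[of x "r - s"] add[of x "(e, r)" "(- e, - s)"] that by (simp add: U_iff L_iff)
    show "(\<exists>r. (x, r) \<in> U) \<longleftrightarrow> (\<exists>s. (x, s) \<in> L)" for x
      using sym[of x e] sym[of x "- e"] unfolding U_iff L_iff by (metis minus_minus)
  qed
  then obtain t where t[measurable]: "t \<in> borel_measurable X"
    and t_ge: "\<And>x r. (x, (e, r)) \<in> K \<Longrightarrow> r \<le> t x"
    and t_le: "\<And>x s. (x, (- e, - s)) \<in> K \<Longrightarrow> t x \<le> s"
    using U_iff L_iff by fast
  have axis: "r \<le> c * t x" if "(x, (c *\<^sub>R e, r)) \<in> K" for x c r
  proof (cases c "0 :: real" rule: linorder_cases)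
    case less
    then have "(x, (- e, - (r / c))) \<in> K" using scale[of "- 1 / c", OF _ that] by simp
    then have "t x \<le> r / c" by (rule t_le)
    then show ?thesis using less by (simp add: field_simps)
  next
    case equal
    then show ?thesis using zero that by simp
  next
    case greater
    then have "(x, (e, r / c)) \<in> K" using scale[of "1 / c", OF _ that] by simp
    then have "r / c \<le> t x" by (rule t_ge)
    then show ?thesis using greater by (simp add: field_simps)
  qed
  \<comment> \<open>The component along \<open>e\<close> is removed together with its contribution
    to the majorant. The image of the cone is taken instead of its intersection with the complement
    of \<open>e\<close>; the new bounds over \<open>0\<close> come from multiples of
    \<open>e\<close> and are controlled by \<open>axis\<close>.\<close>
  define reduce where
    "reduce x p = (fst p - (fst p \<bullet> e) *\<^sub>R e, snd p - (fst p \<bullet> e) * t x)" for x and p :: "'v \<times> real"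
  define K' where "K' = {z \<in> space (X \<Otimes>\<^sub>M borel). \<exists>w r. snd z = reduce (fst z) (w, r) \<and> (fst z, (w, r)) \<in> K}"
  have K'_iff: "(x, q) \<in> K' \<longleftrightarrow> (\<exists>p. q = reduce x p \<and> (x, p) \<in> K)" for x q
    using Ksp by (auto simp: K'_def space_pair_measure)
  have reduce_add: "reduce x (p + p') = reduce x p + reduce x p'" for x p p'
    by (simp add: reduce_def inner_add_left algebra_simps)
  have reduce_scaleR: "reduce x (a *\<^sub>R p) = a *\<^sub>R reduce x p" for x a p
    by (simp add: reduce_def algebra_simps)
  have "\<exists>B \<in> borel_measurable X. \<forall>x w r. (x, (w, r)) \<in> K' \<longrightarrow> r \<le> B x \<bullet> w"
  proof (rule insert.IH)
    show "J \<subseteq> Basis" using insert.prems(1) by simp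
    show "analytic_in (X \<Otimes>\<^sub>M borel) K'"
      unfolding K'_def reduce_def fst_conv snd_conv
      by (intro analytic_in_Collect_ex analytic_in_Collect_conj analytic_in_Collect_mem[OF _ K];
          (rule analytic_in_sets)?; measurable)
    show "(x, p + p') \<in> K'" if "(x, p) \<in> K'" "(x, p') \<in> K'" for x p p'
    proof -
      obtain q q' where "p = reduce x q" "(x, q) \<in> K" "p' = reduce x q'" "(x, q') \<in> K"
        using \<open>(x, p) \<in> K'\<close> \<open>(x, p') \<in> K'\<close> unfolding K'_iff by blast
      then show ?thesis unfolding K'_iff by (intro exI[of _ "q + q'"]) (simp add: reduce_add add)
    qed
    show "(x, a *\<^sub>R p) \<in> K'" if "0 < a" "(x, p) \<in> K'" for x p a
    proof -
      obtain q where "p = reduce x q" "(x, q) \<in> K"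
        using \<open>(x, p) \<in> K'\<close> unfolding K'_iff by blast
      then show ?thesis
        unfolding K'_iff using \<open>0 < a\<close> by (intro exI[of _ "a *\<^sub>R q"]) (simp add: reduce_scaleR scale)
    qed
    show "\<exists>s. (x, (- w, s)) \<in> K'" if wr: "(x, (w, r)) \<in> K'" for x w r
    proof -
      obtain v s where v: "(w, r) = reduce x (v, s)" "(x, (v, s)) \<in> K" using wr unfolding K'_iff by auto
      then obtain s' where "(x, (- v, s')) \<in> K" using sym by blast
      moreover have "reduce x (- v, s') = (- w, s' + (v \<bullet> e) * t x)"
        using v(1) by (simp add: reduce_def)
      ultimately have "(x, (- w, s' + (v \<bullet> e) * t x)) \<in> K'"
        unfolding K'_iff by (intro exI[of _ "(- v, s')"]) simp
      then show ?thesis ..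
    qed
    show "r \<le> 0" if r: "(x, (0, r)) \<in> K'" for x r
    proof -
      obtain v s where v: "(0, r) = reduce x (v, s)" "(x, (v, s)) \<in> K" using r unfolding K'_iff by auto
      then have "v = (v \<bullet> e) *\<^sub>R e" "r = s - (v \<bullet> e) * t x" by (simp_all add: reduce_def)
      then show ?thesis using axis[of x "v \<bullet> e" s] v(2) by simp
    qed
    show "w \<bullet> i = 0" if wr: "(x, (w, r)) \<in> K'" and i: "i \<in> Basis - J" for x w r i
    proof -
      obtain v s where v: "(w, r) = reduce x (v, s)" "(x, (v, s)) \<in> K" using wr unfolding K'_iff by auto
      then have w: "w = v - (v \<bullet> e) *\<^sub>R e" by (simp add: reduce_def)
      show ?thesis
      proof (cases "i = e")
        case True
        then show ?thesis using e by (simp add: w inner_diff_left)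
      next
        case False
        then have "v \<bullet> i = 0" using supp[OF v(2)] i by simp
        then show ?thesis using False e i by (simp add: w inner_diff_left inner_not_same_Basis)
      qed
    qed
  qed
  then obtain B where B[measurable]: "B \<in> borel_measurable X"
    and majorant: "\<And>x w r. (x, (w, r)) \<in> K' \<Longrightarrow> r \<le> B x \<bullet> w" by blast
  show ?case
  \<comment> \<open>The component of \<open>B x\<close> along \<open>e\<close> is replaced by
    \<open>t x\<close>.\<close>
  proof (intro bexI[of _ "\<lambda>x. B x + (t x - B x \<bullet> e) *\<^sub>R e"] allI impI)
    show "(\<lambda>x. B x + (t x - B x \<bullet> e) *\<^sub>R e) \<in> borel_measurable X" by measurable
    fix x w r assume "(x, (w, r)) \<in> K"
    then have "(x, reduce x (w, r)) \<in> K'" unfolding K'_iff by blast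
    then have "r - (w \<bullet> e) * t x \<le> B x \<bullet> (w - (w \<bullet> e) *\<^sub>R e)"
      using majorant by (simp add: reduce_def)
    then show "r \<le> (B x + (t x - B x \<bullet> e) *\<^sub>R e) \<bullet> w"
      by (simp add: inner_diff_right inner_add_left inner_commute[of e w] algebra_simps)
  qed
qed

text \<open>Pointwise boundedness says that the superlevel sets at the natural numbers have empty
  intersection. Novikov separation encloses them in Borel sets with the same property, and the first
  index whose Borel set misses \<open>x\<close> is a Borel bound.\<close>

lemma borel_bound_of_analytic:
  fixes A :: "('a \<times> real) set"
  assumes X: "standard_borel X" and A: "analytic_in (X \<Otimes>\<^sub>M borel) A"
    and bdd: "\<And>x. \<exists>c. \<forall>r. (x, r) \<in> A \<longrightarrow> r \<le> c"
  shows "\<exists>C \<in> borel_measurable X. \<forall>(x, r)\<in>A. r \<le> C x"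
proof -
  define S where "S n = {x \<in> space X. \<exists>r. real n < r \<and> (x, r) \<in> A}" for n :: nat
  have "\<exists>B. (\<forall>n. B n \<in> sets X \<and> S n \<subseteq> B n) \<and> (\<Inter>n. B n) = {}"
  proof (rule analytic_in_novikov_separation[OF X])
    show "analytic_in X (S n)" for n
      unfolding S_def
      by (intro analytic_in_Collect_ex analytic_in_Collect_conj analytic_in_Collect_mem[OF _ A];
          (rule analytic_in_sets)?; measurable)
    show "(\<Inter>n. S n) = {}"
    proof (rule ccontr)
      assume "(\<Inter>n. S n) \<noteq> {}"
      then obtain x where x: "\<And>n. x \<in> S n" by blast
      obtain c where c: "\<And>r. (x, r) \<in> A \<Longrightarrow> r \<le> c" using bdd by blast
      obtain n :: nat where "c < n" using reals_Archimedean2 by blast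
      then show False using x[of n] c by (fastforce simp: S_def)
    qed
  qed
  then obtain B where B: "\<And>n. B n \<in> sets X" "\<And>n. S n \<subseteq> B n" "(\<Inter>n. B n) = {}" by blast
  show ?thesis
  proof (intro bexI[of _ "\<lambda>x. real (LEAST n. x \<notin> B n)"] ballI)
    show "(\<lambda>x. real (LEAST n. x \<notin> B n)) \<in> borel_measurable X"
      using B(1) by measurable
    fix z assume z: "z \<in> A"
    obtain x r where xr: "z = (x, r)" by (cases z)
    then have "x \<in> space X" using analytic_in_subset_space[OF A] z by (auto simp: space_pair_measure)
    obtain m where "x \<notin> B m" using B(3) by blast
    then have "x \<notin> B (LEAST n. x \<notin> B n)" by (rule LeastI)
    then have "x \<notin> S (LEAST n. x \<notin> B n)" using B(2) by blast
    then have "r \<le> real (LEAST n. x \<notin> B n)" using \<open>x \<in> space X\<close> z xr by (force simp: S_def)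
    then show "case z of (x, r) \<Rightarrow> r \<le> real (LEAST n. x \<notin> B n)" by (simp add: xr)
  qed
qed

section \<open>Affine majorants\<close>

theorem theorem4p1:
  fixes X :: "'a measure"
    and Y :: "(real ^ 'n) set"
    and f :: "'a \<times> (real ^ 'n) \<Rightarrow> real"
  assumes "standard_borel X"
    and "Y \<in> sets borel"
    and "upper_semianalytic (X \<Otimes>\<^sub>M restrict_space borel Y) (\<lambda>z. ereal (f z))"
    and "\<exists>(b :: 'a \<Rightarrow> real ^ 'n) (c :: 'a \<Rightarrow> real).
           \<forall>x\<in>space X. \<forall>y\<in>Y. f (x, y) \<le> b x \<bullet> y + c x"
  shows "\<exists>(B :: 'a \<Rightarrow> real ^ 'n) (C :: 'a \<Rightarrow> real).
           B \<in> borel_measurable X \<and> C \<in> borel_measurable X \<and>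
           (\<forall>x\<in>space X. \<forall>y\<in>Y. f (x, y) \<le> B x \<bullet> y + C x)"
proof (cases "Y = {}")
  case True
  then show ?thesis by (intro exI[of _ "\<lambda>_. 0"]) auto
next
  case False
  note X = assms(1) and Y[measurable] = assms(2)
  obtain b c where bc: "\<And>x y. x \<in> space X \<Longrightarrow> y \<in> Y \<Longrightarrow> f (x, y) \<le> b x \<bullet> y + c x"
    using assms(4) by blast
  obtain y1 where y1: "y1 \<in> Y" using False by blast
  \<comment> \<open>A Borel retraction onto \<open>Y\<close> allows quantification over the whole
    Polish space of vectors, with \<open>y \<in> Y\<close> as a separate Borel condition.\<close>
  define \<rho> where "\<rho> y = (if y \<in> Y then y else y1)" for y
  have \<rho>[measurable]: "\<rho> \<in> measurable borel (restrict_space borel Y)"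
    unfolding \<rho>_def using y1 by (intro measurable_restrict_space2) auto
  \<comment> \<open>The hypothesis concerns fixed levels only. Writing \<open>r < f z\<close> as the
    existence of a rational level in between turns a varying \<open>r\<close> into a countable
    union.\<close>
  define A where "A q = {z \<in> space (X \<Otimes>\<^sub>M restrict_space borel Y). of_rat q < f z}" for q :: rat
  have A: "analytic_in (X \<Otimes>\<^sub>M restrict_space borel Y) (A q)" for q
    using assms(3) unfolding upper_semianalytic_def A_def by simp
  \<comment> \<open>The fibre over \<open>x\<close> is the strict hypograph of the section of
    \<open>f\<close>, lifted to height \<open>1\<close>. In the cone this extra coordinate records
    the total weight of a combination, so affine majorants become linear.\<close>
  define G :: "('a \<times> ((real ^ 'n) \<times> real) \<times> real) set" where
    "G = {z \<in> space (X \<Otimes>\<^sub>M borel). \<exists>y r. (y \<in> Y \<and> snd z = ((y, 1), r)) \<and>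
      (\<exists>q. r < of_rat q \<and> (fst z, \<rho> y) \<in> A q)}"
  have G: "analytic_in (X \<Otimes>\<^sub>M borel) G"
    unfolding G_def
    by (intro analytic_in_Collect_ex analytic_in_Collect_conj analytic_in_Collect_ex_countable
        analytic_in_Collect_mem[OF _ A]; (rule analytic_in_sets)?; measurable)
  have G_iff: "(x, ((y, s), r)) \<in> G \<longleftrightarrow> x \<in> space X \<and> y \<in> Y \<and> s = 1 \<and> r < f (x, y)" for x y s r
    using of_rat_dense[of r "f (x, y)"]
    by (auto simp: G_def A_def \<rho>_def space_pair_measure space_restrict_space)
  define H where "H x = pos_hull {w. (x, w) \<in> G}" for x
  define \<K> where "\<K> = {z \<in> space (X \<Otimes>\<^sub>M borel). snd z \<in> H (fst z)}"
  have \<K>: "analytic_in (X \<Otimes>\<^sub>M borel) \<K>"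
    unfolding \<K>_def H_def by (rule analytic_in_pos_hull[OF G])
  have \<K>_iff: "(x, w) \<in> \<K> \<longleftrightarrow> x \<in> space X \<and> w \<in> H x" for x w
    by (simp add: \<K>_def space_pair_measure)
  have H_base: "((y, 1), r) \<in> H x" if "x \<in> space X" "y \<in> Y" "r < f (x, y)" for x y r
    using subset_pos_hull[of "{w. (x, w) \<in> G}"] that by (auto simp: H_def G_iff)
  have H_add: "w + w' \<in> H x" if "w \<in> H x" "w' \<in> H x" for x w w'
    using that unfolding H_def by (rule pos_hull_add)
  have H_scaleR: "a *\<^sub>R w \<in> H x" if "0 < a" "w \<in> H x" for x a w
    using that unfolding H_def by (rule pos_hull_scaleR)
  have H_scale: "((a *\<^sub>R y, a * s), a * r) \<in> H x" if "((y, s), r) \<in> H x" "0 < a" for x y s r a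
    using H_scaleR[OF that(2,1)] by simp
  have H_bound: "r \<le> b x \<bullet> y + c x * s \<and> 0 < s \<and> (1 / s) *\<^sub>R y \<in> convex hull Y"
    if "((y, s), r) \<in> H x" for x y s r
  proof -
    \<comment> \<open>All three conditions pass from the generators to the cone; for sums, the
      normalised point is the average with weights proportional to \<open>s\<close> and
      \<open>s'\<close>.\<close>
    define T where "T = {((y, s), r). r \<le> b x \<bullet> y + c x * s \<and> 0 < s \<and> (1 / s) *\<^sub>R y \<in> convex hull Y}"
    have "H x \<subseteq> T"
      unfolding H_def
    proof (rule pos_hull_subset)
      show "{w. (x, w) \<in> G} \<subseteq> T"
        using bc by (fastforce simp: T_def G_iff intro: hull_inc)
    next
      fix w w' assume "w \<in> T" "w' \<in> T"
      then obtain y s r y' s' r' where w: "w = ((y, s), r)" "w' = ((y', s'), r')"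
        and T: "r \<le> b x \<bullet> y + c x * s" "0 < s" "(1 / s) *\<^sub>R y \<in> convex hull Y"
          "r' \<le> b x \<bullet> y' + c x * s'" "0 < s'" "(1 / s') *\<^sub>R y' \<in> convex hull Y"
        by (auto simp: T_def)
      have "(s / (s + s')) *\<^sub>R ((1 / s) *\<^sub>R y) + (s' / (s + s')) *\<^sub>R ((1 / s') *\<^sub>R y') \<in> convex hull Y"
        using T by (intro convexD convex_convex_hull) (auto simp flip: add_divide_distrib)
      then have "(1 / (s + s')) *\<^sub>R (y + y') \<in> convex hull Y" using T by (simp add: scaleR_add_right)
      then show "w + w' \<in> T" using T by (simp add: w T_def inner_add_right algebra_simps)
    next
      fix a :: real and w assume "0 < a" "w \<in> T"
      then show "a *\<^sub>R w \<in> T"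
        by (auto simp: T_def simp flip: distrib_left mult.left_commute[of a] intro: mult_left_mono)
    qed
    then show ?thesis using that by (auto simp: T_def)
  qed
  have H_hull: "\<exists>r. ((y, 1), r) \<in> H x" if x: "x \<in> space X" and y: "y \<in> convex hull Y" for x y
  proof -
    have "convex hull Y \<subseteq> {y. \<exists>r. ((y, 1), r) \<in> H x}"
    proof (rule hull_minimal)
      show "Y \<subseteq> {y. \<exists>r. ((y, 1), r) \<in> H x}" using H_base[OF x] lt_ex by blast
      show "convex {y. \<exists>r. ((y, 1), r) \<in> H x}"
      proof (rule convexI, clarify)
        fix y y' r r' and u v :: real
        assume H: "((y, 1), r) \<in> H x" "((y', 1), r') \<in> H x" and uv: "0 \<le> u" "0 \<le> v" "u + v = 1"
        \<comment> \<open>The endpoints are treated apart because the cone is closed only under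
          strictly positive scaling.\<close>
        consider "u = 0" "v = 1" | "v = 0" "u = 1" | "0 < u" "0 < v" using uv by fastforce
        then show "\<exists>r. ((u *\<^sub>R y + v *\<^sub>R y', 1), r) \<in> H x"
        proof cases
          case 3
          have "((u *\<^sub>R y, u * 1), u * r) + ((v *\<^sub>R y', v * 1), v * r') \<in> H x"
            by (intro H_add H_scale H 3)
          then show ?thesis using uv(3) by auto
        qed (use H in auto)
      qed
    qed
    then show ?thesis using y by blast
  qed

  \<comment> \<open>Normalisation at a point of the relative interior\<close>
  have "rel_interior (convex hull Y) \<noteq> {}" using False by (simp add: rel_interior_eq_empty)
  then obtain y0 where y0: "y0 \<in> rel_interior (convex hull Y)" by blast
  \<comment> \<open>Any segment of the hull ending at \<open>y0\<close> can be prolonged beyond it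
    within the hull; this makes the translated domain symmetric below.\<close>
  have reflect: "\<exists>e>1. (1 - e) *\<^sub>R y + e *\<^sub>R y0 \<in> convex hull Y" if "y \<in> convex hull Y" for y
    using y0 that convex_rel_interior_iff[of "convex hull Y" y0] False by auto
  \<comment> \<open>The maps \<open>b\<close> and \<open>c\<close> enter through finiteness alone:
    they bound the values of the cone over \<open>(y0, 1)\<close> for each \<open>x\<close>.\<close>
  have "\<exists>C \<in> borel_measurable X.
      \<forall>(x, r)\<in>{z \<in> space (X \<Otimes>\<^sub>M borel). (fst z, ((y0, 1), snd z)) \<in> \<K>}. r \<le> C x"
  proof (rule borel_bound_of_analytic[OF X])
    show "analytic_in (X \<Otimes>\<^sub>M borel) {z \<in> space (X \<Otimes>\<^sub>M borel). (fst z, ((y0, 1), snd z)) \<in> \<K>}"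
      by (rule analytic_in_Collect_mem[OF _ \<K>]) measurable
    show "\<exists>d. \<forall>r. (x, r) \<in> {z \<in> space (X \<Otimes>\<^sub>M borel). (fst z, ((y0, 1), snd z)) \<in> \<K>} \<longrightarrow> r \<le> d" for x
      using H_bound[of y0 1 _ x] by (intro exI[of _ "b x \<bullet> y0 + c x * 1"]) (auto simp: \<K>_iff)
  qed
  then obtain C where C[measurable]: "C \<in> borel_measurable X"
    and C_ge: "\<And>x r. x \<in> space X \<Longrightarrow> ((y0, 1), r) \<in> H x \<Longrightarrow> r \<le> C x"
    by (auto simp: \<K>_iff space_pair_measure)
  \<comment> \<open>This is the homogeneous form of moving \<open>y0\<close> to the origin and
    subtracting \<open>C x\<close>. It eliminates the weight coordinate.\<close>
  define red where "red x w = (fst (fst w) - snd (fst w) *\<^sub>R y0, snd w - snd (fst w) * C x)"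
    for x and w :: "((real ^ 'n) \<times> real) \<times> real"
  define K where "K = {z \<in> space (X \<Otimes>\<^sub>M borel).
    \<exists>y s r. snd z = red (fst z) ((y, s), r) \<and> (fst z, ((y, s), r)) \<in> \<K>}"
  have K_iff: "(x, p) \<in> K \<longleftrightarrow> x \<in> space X \<and> (\<exists>w. p = red x w \<and> w \<in> H x)" for x p
    by (auto simp: K_def \<K>_iff space_pair_measure)
  have red_add: "red x (w + w') = red x w + red x w'" for x w w'
    by (simp add: red_def algebra_simps)
  have red_scaleR: "red x (a *\<^sub>R w) = a *\<^sub>R red x w" for x a w
    by (simp add: red_def algebra_simps)
  have "\<exists>B \<in> borel_measurable X. \<forall>x w r. (x, (w, r)) \<in> K \<longrightarrow> r \<le> B x \<bullet> w"
  proof (rule borel_linear_majorant_on[OF X finite_Basis subset_refl])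
    show "analytic_in (X \<Otimes>\<^sub>M borel) K"
      unfolding K_def red_def fst_conv snd_conv
      by (intro analytic_in_Collect_ex analytic_in_Collect_conj analytic_in_Collect_mem[OF _ \<K>];
          (rule analytic_in_sets)?; measurable)
    show "(x, p + p') \<in> K" if "(x, p) \<in> K" "(x, p') \<in> K" for x p p'
    proof -
      obtain w w' where "x \<in> space X" "p = red x w" "w \<in> H x" "p' = red x w'" "w' \<in> H x"
        using \<open>(x, p) \<in> K\<close> \<open>(x, p') \<in> K\<close> unfolding K_iff by blast
      then show ?thesis unfolding K_iff by (intro conjI exI[of _ "w + w'"]) (simp_all add: red_add H_add)
    qed
    show "(x, a *\<^sub>R p) \<in> K" if "0 < a" "(x, p) \<in> K" for x p a
    proof -
      obtain w where "x \<in> space X" "p = red x w" "w \<in> H x"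
        using \<open>(x, p) \<in> K\<close> unfolding K_iff by blast
      then show ?thesis
        unfolding K_iff using \<open>0 < a\<close>
        by (intro conjI exI[of _ "a *\<^sub>R w"]) (simp_all add: red_scaleR H_scaleR)
    qed
    show "\<exists>r. (x, (- w, r)) \<in> K" if wr: "(x, (w, r)) \<in> K" for x w r
    proof -
      obtain y s r' where x: "x \<in> space X" and y: "(w, r) = red x ((y, s), r')" "((y, s), r') \<in> H x"
        using wr unfolding K_iff by auto
      have s: "0 < s" "(1 / s) *\<^sub>R y \<in> convex hull Y" using H_bound[OF y(2)] by auto
      obtain e where e: "1 < e" "(1 - e) *\<^sub>R (1 / s) *\<^sub>R y + e *\<^sub>R y0 \<in> convex hull Y"
        using reflect[OF s(2)] by blast
      define z where "z = (1 - e) *\<^sub>R (1 / s) *\<^sub>R y + e *\<^sub>R y0"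
      \<comment> \<open>Since \<open>z - y0\<close> equals \<open>1 - e\<close> times
        \<open>(1 / s) *\<^sub>R y - y0\<close>, this factor turns it into
        \<open>- (y - s *\<^sub>R y0)\<close>, which is \<open>- w\<close>.\<close>
      define l where "l = s / (e - 1)"
      have l: "0 < l" "l * (1 - e) = - s" using s(1) e(1) by (auto simp: l_def field_simps)
      obtain r'' where "((z, 1), r'') \<in> H x" using H_hull[OF x] e(2) unfolding z_def by blast
      then have "((l *\<^sub>R z, l * 1), l * r'') \<in> H x" using H_scale l(1) by blast
      moreover have "l *\<^sub>R z - l *\<^sub>R y0 = - w"
      proof -
        have "l *\<^sub>R ((1 - e) *\<^sub>R v + e *\<^sub>R y0) - l *\<^sub>R y0 = (l * (1 - e)) *\<^sub>R (v - y0)" for v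
          by (simp add: algebra_simps)
        then have "l *\<^sub>R z - l *\<^sub>R y0 = (l * (1 - e)) *\<^sub>R ((1 / s) *\<^sub>R y - y0)"
          unfolding z_def .
        also have "\<dots> = - w" unfolding l(2) using s(1) y(1) by (simp add: red_def scaleR_diff_right)
        finally show ?thesis .
      qed
      ultimately have "(x, (- w, l * r'' - l * C x)) \<in> K"
        unfolding K_iff using x
        by (intro conjI exI[of _ "((l *\<^sub>R z, l * 1), l * r'')"]) (simp_all add: red_def)
      then show ?thesis ..
    qed
    show "r \<le> 0" if r: "(x, (0, r)) \<in> K" for x r
    proof -
      obtain y s r' where x: "x \<in> space X" and y: "(0, r) = red x ((y, s), r')" "((y, s), r') \<in> H x"
        using r unfolding K_iff by auto
      have s: "0 < s" using H_bound[OF y(2)] by auto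
      \<comment> \<open>A point reduced to the origin lies on the ray through
        \<open>(y0, 1)\<close>, where \<open>C\<close> was chosen as a bound.\<close>
      have "y = s *\<^sub>R y0" "r = r' - s * C x" using y(1) by (auto simp: red_def)
      then have "((y0, 1), r' / s) \<in> H x" using H_scale[OF y(2), of "1 / s"] s by simp
      then have "r' / s \<le> C x" by (rule C_ge[OF x])
      then show ?thesis using s \<open>r = r' - s * C x\<close> by (simp add: field_simps)
    qed
  qed simp
  then obtain B where B[measurable]: "B \<in> borel_measurable X"
    and majorant: "\<And>x w r. (x, (w, r)) \<in> K \<Longrightarrow> r \<le> B x \<bullet> w" by blast
  have "f (x, y) \<le> B x \<bullet> y + (C x - B x \<bullet> y0)" if x: "x \<in> space X" and y: "y \<in> Y" for x y
  \<comment> \<open>The generators lie strictly below \<open>f\<close>, so the value of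
    \<open>f\<close> itself is reached as a limit.\<close>
  proof (rule dense_le)
    fix r assume "r < f (x, y)"
    then have "(x, red x ((y, 1), r)) \<in> K" using H_base x y unfolding K_iff by blast
    then have "r - C x \<le> B x \<bullet> (y - y0)" using majorant by (simp add: red_def)
    then show "r \<le> B x \<bullet> y + (C x - B x \<bullet> y0)" by (simp add: inner_diff_right)
  qed
  then show ?thesis
    by (intro exI[of _ B] exI[of _ "\<lambda>x. C x - B x \<bullet> y0"]) auto
qed

end
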